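(* Let $(D,r)$ be a connected rooted digraph such that every cut-edge of $D$ is branching. Then $\mathrm{maxleaf}(D)\ge \frac{|\mathrm{sp}(D)|}{30}-\mathrm{cv}(D)$ and $\mathrm{maxleaf}(D)\ge \frac{|\mathrm{sp}(D)|}{60}$.
   Context: A rooted digraph $(D,r)$ is a finite digraph without loops or parallel arcs (arcs $(u,v)$ and $(v,u)$ may both be present) with a distinguished root $r$ of in-degree $0$. $D$ is connected if every vertex is reachable from $r$. An outbranching rooted at $r$ is a spanning subgraph $T$ of $D$ whose underlying undirected graph is a tree with all arcs oriented away from $r$; its leaves are its vertices of out-degree $0$. $\mathrm{maxleaf}(D)$ is the maximum number of leaves of an outbranching of $D$ rooted at $r$. A cut-vertex is a vertex $v\ne r$ such that some vertex is not reachable from $r$ in $D-v$; $\mathrm{cv}(D)$ is the number of cut-vertices. A cut-edge is an arc $e$ such that some vertex is not reachable from $r$ in $D-e$. A cut-edge $(u,v)$ is branching if there is another cut-edge with tail $u$. A vertex $v$ is special if its in-degree is at least $3$ or there is an arc $(u,v)$ with $(v,u)\notin E(D)$; $\mathrm{sp}(D)$ is the set of special vertices. *)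

theory Defs
  imports Complex_Main "Graph_Theory.Digraph_Component"
begin

text \<open>
  The library locale \<^locale>\<open>digraph\<close> provides exactly the finite digraphs without loops and
  without parallel arcs; antiparallel arcs are allowed.
\<close>

locale rooted_digraph = digraph D for D :: "('a, 'b) pre_digraph" and r :: 'a +
  assumes root_in_verts: "r \<in> verts D"
    and root_in_degree: "in_degree D r = 0"

definition root_connected :: "('a, 'b) pre_digraph \<Rightarrow> 'a \<Rightarrow> bool" where
  "root_connected D r \<longleftrightarrow> (\<forall>v \<in> verts D. r \<rightarrow>\<^sup>*\<^bsub>D\<^esub> v)"

text \<open>
  The library predicates \<^const>\<open>forest\<close> and \<^const>\<open>tree\<close> refer to directed cycles, so they do not
  express that the underlying undirected graph is a tree. Undirected walks of \<open>T\<close> are the walks of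
  \<^term>\<open>mk_symmetric T\<close>, which replaces every arc by a pair of opposite arcs. A closed walk of
  length 2 there only runs back and forth along one edge and is not an undirected cycle.
\<close>

definition underlying_tree :: "('a, 'b) pre_digraph \<Rightarrow> bool" where
  "underlying_tree T \<longleftrightarrow>
     Digraph_Component.connected T \<and>
     \<not> (\<exists>p. pre_digraph.cycle (with_proj (mk_symmetric T)) p \<and> length p \<noteq> 2)"

text \<open>
  In a tree the path from \<open>r\<close> to the head of an arc is unique; the arc points away from \<open>r\<close> if its
  tail lies on that path. In particular two antiparallel arcs cannot both point away from \<open>r\<close>.
\<close>

definition oriented_away :: "('a, 'b) pre_digraph \<Rightarrow> 'a \<Rightarrow> bool" where
  "oriented_away T r \<longleftrightarrow>
     (\<forall>e \<in> arcs T. \<forall>p. pre_digraph.apath (with_proj (mk_symmetric T)) r p (head T e) \<longrightarrow>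
        tail T e \<in> set (pre_digraph.awalk_verts (with_proj (mk_symmetric T)) r p))"

definition outbranching :: "('a, 'b) pre_digraph \<Rightarrow> 'a \<Rightarrow> ('a, 'b) pre_digraph \<Rightarrow> bool" where
  "outbranching D r T \<longleftrightarrow> spanning T D \<and> underlying_tree T \<and> oriented_away T r"

definition leaves :: "('a, 'b) pre_digraph \<Rightarrow> 'a set" where
  "leaves T = {v \<in> verts T. out_degree T v = 0}"

text \<open>
  A connected rooted digraph has an outbranching, and leaf numbers are bounded by the number of
  vertices, so the maximum below is over a finite nonempty set.
\<close>

definition maxleaf :: "('a, 'b) pre_digraph \<Rightarrow> 'a \<Rightarrow> nat" where
  "maxleaf D r = Max {card (leaves T) | T. outbranching D r T}"

definition cut_vertex :: "('a, 'b) pre_digraph \<Rightarrow> 'a \<Rightarrow> 'a \<Rightarrow> bool" where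
  "cut_vertex D r v \<longleftrightarrow>
     v \<in> verts D \<and> v \<noteq> r \<and>
     (\<exists>w \<in> verts (pre_digraph.del_vert D v). \<not> r \<rightarrow>\<^sup>*\<^bsub>pre_digraph.del_vert D v\<^esub> w)"

definition cv :: "('a, 'b) pre_digraph \<Rightarrow> 'a \<Rightarrow> nat" where
  "cv D r = card {v. cut_vertex D r v}"

definition cut_edge :: "('a, 'b) pre_digraph \<Rightarrow> 'a \<Rightarrow> 'b \<Rightarrow> bool" where
  "cut_edge D r e \<longleftrightarrow>
     e \<in> arcs D \<and>
     (\<exists>w \<in> verts (pre_digraph.del_arc D e). \<not> r \<rightarrow>\<^sup>*\<^bsub>pre_digraph.del_arc D e\<^esub> w)"

definition branching_cut_edge :: "('a, 'b) pre_digraph \<Rightarrow> 'a \<Rightarrow> 'b \<Rightarrow> bool" where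
  "branching_cut_edge D r e \<longleftrightarrow>
     cut_edge D r e \<and> (\<exists>f. cut_edge D r f \<and> f \<noteq> e \<and> tail D f = tail D e)"

definition sp :: "('a, 'b) pre_digraph \<Rightarrow> 'a set" where
  "sp D = {v \<in> verts D. in_degree D v \<ge> 3 \<or> (\<exists>u. u \<rightarrow>\<^bsub>D\<^esub> v \<and> \<not> v \<rightarrow>\<^bsub>D\<^esub> u)}"

end

theory Submission
  imports Defs "HOL-Library.Sublist"
begin

text \<open>
  A rooted connected digraph has two strict partial orders such that every vertex other than the root
  has an in-neighbour before it in either order, and a vertex that is not a cut-vertex never precedes
  another vertex in both orders. Without cut-vertices these come from an ordering in which every vertex
  lies between two of its in-neighbours; in general cut-vertices are split off one at a time.

  Choosing parents along the two orders gives two outbranchings. If no outbranching has more than \<open>l\<close>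
  leaves, then each of them has \<open>O(l)\<close> vertices with siblings and \<open>O(l)\<close> vertices with an
  in-neighbour that is neither their parent nor a descendant, since such an in-neighbour may serve as an
  alternative parent. A special vertex that is not exceptional in this sense has just its two parents as
  in-neighbours, and the properties of the orders allow charging it to an exceptional vertex or to a
  cut-vertex. Finally, if all cut-edges are branching, every cut-vertex has two children in a suitable
  outbranching, so there are at most \<open>l\<close> cut-vertices.
\<close>

section \<open>Orders between two roots\<close>

text \<open>Choosing for every vertex an in-neighbour that precedes it in a fixed strict order never
  creates a cycle. So parents along one order can be exchanged independently of one another, and
  this freedom turns many alternative parents into many leaves. An alternative parent of
  \<open>v\<close> that is not a descendant of \<open>v\<close> need not respect a prescribed order,
  but it respects one of two opposite preorder traversals, at the cost of a factor 2. Separation is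
  expressed throughout by \<open>entry\<close>, the vertices outside a set that send an arc into it.
  It counts vertices rather than arcs and behaves well under contraction, so both cut-vertices and
  the hypothesis for ordering between two roots become conditions on its size. With k cut-vertices
  the count yields 30l + 4k special vertices, where 30 = 6 + 6 + 2 + 8 + 8 collects the exceptional
  sets. The two claims then come from bounding k once by itself and once by l.\<close>

definition entry :: "('v \<times> 'v) set \<Rightarrow> 'v set \<Rightarrow> 'v set" where
  "entry E S = E\<inverse> `` S - S"

definition quot :: "('v \<Rightarrow> 'v) \<Rightarrow> ('v \<times> 'v) set \<Rightarrow> ('v \<times> 'v) set" where
  "quot p E = {(p u, p v) | u v. (u, v) \<in> E \<and> p u \<noteq> p v}"

text \<open>Substitution of orders: the fibres of \<open>p\<close> are placed as \<open>L\<close>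
  orders their images, and \<open>M\<close> orders each fibre inside. It serves both to insert a
  single vertex and to expand a contracted set.\<close>

definition lex_over :: "('v \<Rightarrow> 'v) \<Rightarrow> ('v \<times> 'v) set \<Rightarrow> ('v \<times> 'v) set \<Rightarrow> ('v \<times> 'v) set" where
  "lex_over p L M = {(x, y). (p x, p y) \<in> L \<or> p x = p y \<and> (x, y) \<in> M}"

text \<open>An arc dropped by \<open>quot\<close> as a loop has both ends in one fibre, and a fibre
  lies entirely inside or outside the preimage of \<open>A\<close>; so no such arc enters that
  preimage.\<close>

lemma entry_quot: "entry (quot p E) A = p ` entry E (p -` A)"
  unfolding entry_def quot_def by (auto simp: image_iff)

lemma finite_entry: "finite E \<Longrightarrow> finite (entry E A)"
  unfolding entry_def by (simp add: finite_Image)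

lemma quot_image: "quot p E \<subseteq> map_prod p p ` E"
  unfolding quot_def by force

lemma card_quot: "finite E \<Longrightarrow> card (quot p E) \<le> card E"
  using quot_image by (metis card_image_le card_mono finite_imageI le_trans)

lemma trans_lex_over: "trans L \<Longrightarrow> trans M \<Longrightarrow> trans (lex_over p L M)"
  unfolding lex_over_def trans_def by (auto; metis)

lemma irrefl_lex_over: "irrefl L \<Longrightarrow> irrefl M \<Longrightarrow> irrefl (lex_over p L M)"
  unfolding lex_over_def irrefl_def by auto

lemma total_on_lex_over:
  assumes "total_on A L" "p ` B \<subseteq> A" "\<And>x y. x \<in> B \<Longrightarrow> y \<in> B \<Longrightarrow> x \<noteq> y \<Longrightarrow> p x = p y \<Longrightarrow> (x, y) \<in> M \<or> (y, x) \<in> M"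
  shows "total_on B (lex_over p L M)"
  using assms unfolding lex_over_def total_on_def image_subset_iff by blast

section \<open>Inserting a vertex into a linear order\<close>

lemma insert_after:
  assumes "trans L" "irrefl L" "total_on A L" "y \<in> A" "v \<notin> A"
  obtains M where "trans M" "irrefl M" "total_on (insert v A) M"
    "\<And>a b. a \<in> A \<Longrightarrow> b \<in> A \<Longrightarrow> (a, b) \<in> M \<longleftrightarrow> (a, b) \<in> L"
    "(y, v) \<in> M" "\<And>z. z \<in> A \<Longrightarrow> (y, z) \<in> L \<Longrightarrow> (v, z) \<in> M"
proof
  let ?p = "id(v := y)"
  \<comment> \<open>Doubling \<open>y\<close> and breaking the tie in favour of \<open>y\<close>
    places \<open>v\<close> directly after \<open>y\<close>.\<close>
  let ?M = "lex_over ?p L {(y, v)}"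
  have [simp]: "y \<noteq> v" using assms by auto
  show "trans ?M" using assms by (intro trans_lex_over) (auto simp: trans_def)
  show "irrefl ?M" using assms by (intro irrefl_lex_over) (auto simp: irrefl_def)
  show "total_on (insert v A) ?M"
    by (rule total_on_lex_over[OF assms(3)]) (use assms(4) in \<open>auto split: if_splits\<close>)
  show "\<And>a b. a \<in> A \<Longrightarrow> b \<in> A \<Longrightarrow> (a, b) \<in> ?M \<longleftrightarrow> (a, b) \<in> L"
    using assms(5) unfolding lex_over_def by auto
  show "(y, v) \<in> ?M" unfolding lex_over_def by auto
  show "\<And>z. z \<in> A \<Longrightarrow> (y, z) \<in> L \<Longrightarrow> (v, z) \<in> ?M"
    using assms(5) unfolding lex_over_def by auto
qed

text \<open>One of \<open>y1\<close>, \<open>y2\<close> lies beyond \<open>w\<close>, hence the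
  later one does. The place right after the maximum of \<open>w\<close> and the earlier one is still
  before the later one.\<close>

lemma insert_beyond:
  assumes L: "trans L" "irrefl L" "total_on A L" and "v \<notin> A"
    and "w \<in> A" "y1 \<in> A" "y2 \<in> A" "y1 \<noteq> y2" "(w, y1) \<in> L \<or> (w, y2) \<in> L"
  obtains M where "trans M" "irrefl M" "total_on (insert v A) M"
    "\<And>a b. a \<in> A \<Longrightarrow> b \<in> A \<Longrightarrow> (a, b) \<in> M \<longleftrightarrow> (a, b) \<in> L"
    "(w, v) \<in> M" "(y1, v) \<in> M \<and> (v, y2) \<in> M \<or> (y2, v) \<in> M \<and> (v, y1) \<in> M"
proof -
  have "\<exists>a b. {a, b} = {y1, y2} \<and> (a, b) \<in> L"
    using assms(6-8) L(3) unfolding total_on_def by blast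
  then obtain a b where ab: "{a, b} = {y1, y2}" "(a, b) \<in> L" by blast
  then have abA: "a \<in> A" "b \<in> A" and wb: "(w, b) \<in> L"
    using assms(6,7,9) L(1) by (auto simp: doubleton_eq_iff dest: transD)
  define y where "y = (if (w, a) \<in> L then a else w)"
  have y: "y \<in> A" "(y, b) \<in> L" using abA wb ab \<open>w \<in> A\<close> unfolding y_def by auto
  obtain M where M: "trans M" "irrefl M" "total_on (insert v A) M"
    "\<And>a b. a \<in> A \<Longrightarrow> b \<in> A \<Longrightarrow> (a, b) \<in> M \<longleftrightarrow> (a, b) \<in> L"
    "(y, v) \<in> M" "\<And>z. z \<in> A \<Longrightarrow> (y, z) \<in> L \<Longrightarrow> (v, z) \<in> M"
    using insert_after[OF L y(1) \<open>v \<notin> A\<close>] by blast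
  have "(w, v) \<in> M"
    using M(5) M(4)[OF \<open>w \<in> A\<close> \<open>y \<in> A\<close>] transD[OF M(1), of w y v] unfolding y_def by (auto split: if_splits)
  moreover have "(a, v) \<in> M"
  proof (cases "a = y")
    case False
    then have "(a, y) \<in> L" using L(3) abA \<open>w \<in> A\<close> unfolding y_def total_on_def by (auto split: if_splits)
    then show ?thesis using M(4)[OF \<open>a \<in> A\<close> \<open>y \<in> A\<close>] transD[OF M(1), of a y v] M(5) by blast
  qed (use M(5) in simp)
  moreover have "(v, b) \<in> M" using M(6) abA y by blast
  ultimately show ?thesis using that[OF M(1-4)] ab(1) by (auto simp: doubleton_eq_iff)
qed

text \<open>This undoes the contraction of \<open>v\<close> into its only out-neighbour
  \<open>w\<close>: \<open>y1\<close> and \<open>y2\<close> are the in-neighbours of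
  \<open>v\<close>, and \<open>x\<close> is the other in-neighbour of \<open>w\<close>. If
  \<open>x\<close> precedes \<open>w\<close>, then the in-neighbour \<open>u2\<close> after
  \<open>w\<close> must be \<open>y1\<close> or \<open>y2\<close>, so \<open>v\<close> fits beyond
  \<open>w\<close>. The other case is the same for the converse order.\<close>

lemma insert_beside:
  assumes L: "trans L" "irrefl L" "total_on A L" and "v \<notin> A"
    and "w \<in> A" "x \<in> A" "x \<noteq> w" "y1 \<in> A" "y2 \<in> A" "y1 \<noteq> y2"
    and "u1 \<in> {x, y1, y2}" "u2 \<in> {x, y1, y2}" "(u1, w) \<in> L" "(w, u2) \<in> L"
  obtains M where "trans M" "irrefl M" "total_on (insert v A) M"
    "\<And>a b. a \<in> A \<Longrightarrow> b \<in> A \<Longrightarrow> (a, b) \<in> M \<longleftrightarrow> (a, b) \<in> L"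
    "(x, w) \<in> M \<and> (w, v) \<in> M \<or> (v, w) \<in> M \<and> (w, x) \<in> M"
    "(y1, v) \<in> M \<and> (v, y2) \<in> M \<or> (y2, v) \<in> M \<and> (v, y1) \<in> M"
proof (cases "(x, w) \<in> L")
  case True
  then have "(w, x) \<notin> L" using L(1,2) unfolding irrefl_def by (meson transD)
  then have "(w, y1) \<in> L \<or> (w, y2) \<in> L" using assms(12,14) by auto
  from insert_beyond[OF L assms(4,5,8,9,10) this] that True \<open>w \<in> A\<close> \<open>x \<in> A\<close> show thesis by metis
next
  case False
  then have wx: "(w, x) \<in> L" using L(3) assms(5-7) unfolding total_on_def by blast
  have Lc: "trans (L\<inverse>)" "irrefl (L\<inverse>)" "total_on A (L\<inverse>)" using L by (auto simp: irrefl_def)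
  have "(w, y1) \<in> L\<inverse> \<or> (w, y2) \<in> L\<inverse>" using assms(11,13) False by auto
  from insert_beyond[OF Lc assms(4,5,8,9,10) this] obtain M where M: "trans M" "irrefl M" "total_on (insert v A) M"
    "\<And>a b. a \<in> A \<Longrightarrow> b \<in> A \<Longrightarrow> (a, b) \<in> M \<longleftrightarrow> (a, b) \<in> L\<inverse>"
    "(w, v) \<in> M" "(y1, v) \<in> M \<and> (v, y2) \<in> M \<or> (y2, v) \<in> M \<and> (v, y1) \<in> M" by blast
  have "trans (M\<inverse>)" "irrefl (M\<inverse>)" "total_on (insert v A) (M\<inverse>)" using M by (auto simp: irrefl_def)
  then show thesis using M(4-6) wx assms(5,6) by (intro that[of "M\<inverse>"]) auto
qed

section \<open>Directed analogue of st-numberings\<close>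

definition st_order :: "'v set \<Rightarrow> ('v \<times> 'v) set \<Rightarrow> 'v \<Rightarrow> 'v \<Rightarrow> ('v \<times> 'v) set \<Rightarrow> bool" where
  "st_order V E s t L \<longleftrightarrow> trans L \<and> irrefl L \<and> total_on V L \<and> (s, t) \<in> L \<and>
     (\<forall>v \<in> V - {s, t}. (s, v) \<in> L \<and> (v, t) \<in> L \<and> (\<exists>u. (u, v) \<in> E \<and> (u, v) \<in> L) \<and> (\<exists>w. (w, v) \<in> E \<and> (v, w) \<in> L))"

text \<open>By Menger's theorem the condition on sets says that every inner vertex is the end of a
  path from \<open>s\<close> and of one from \<open>t\<close> that share no other vertex. The cut
  form is the one that can be checked after contractions and deletions.\<close>

definition st_connected :: "'v set \<Rightarrow> ('v \<times> 'v) set \<Rightarrow> 'v \<Rightarrow> 'v \<Rightarrow> bool" where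
  "st_connected V E s t \<longleftrightarrow> finite V \<and> s \<in> V \<and> t \<in> V \<and> s \<noteq> t \<and> E \<subseteq> V \<times> (V - {s, t}) \<and> irrefl E \<and>
     (\<forall>A \<subseteq> V - {s, t}. A \<noteq> {} \<longrightarrow> card (entry E A) \<ge> 2)"

lemma st_orderI:
  assumes "trans L" "irrefl L" "total_on V L" "(s, t) \<in> L"
    and "\<And>v. v \<in> V - {s, t} \<Longrightarrow> (s, v) \<in> L \<and> (v, t) \<in> L \<and> (\<exists>u. (u, v) \<in> E \<and> (u, v) \<in> L) \<and> (\<exists>w. (w, v) \<in> E \<and> (v, w) \<in> L)"
  shows "st_order V E s t L"
  using assms unfolding st_order_def by blast

lemma st_connectedI:
  assumes "finite V" "s \<in> V" "t \<in> V" "s \<noteq> t" "E \<subseteq> V \<times> (V - {s, t})" "irrefl E"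
    "\<And>A. A \<subseteq> V - {s, t} \<Longrightarrow> A \<noteq> {} \<Longrightarrow> card (entry E A) \<ge> 2"
  shows "st_connected V E s t"
  using assms unfolding st_connected_def by blast

lemma st_connected_finite: "st_connected V E s t \<Longrightarrow> finite E"
  unfolding st_connected_def by (meson finite_Diff finite_SigmaI finite_subset)

text \<open>\<open>S\<close> is contracted to one of its vertices \<open>c\<close>, and the order
  obtained shows which entry vertex, \<open>a\<close>, comes before \<open>S\<close> and which,
  \<open>b\<close>, comes after. Then \<open>S\<close> is ordered between \<open>a\<close> and
  \<open>b\<close> and substituted for \<open>c\<close>. Maximality keeps the contracted digraph
  connected; \<open>entry E S \<noteq> {s, t}\<close> makes the digraph on \<open>S\<close> with
  \<open>a\<close> and \<open>b\<close> smaller than the original one.\<close>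

lemma st_order_tight_set:
  fixes V :: "'v set"
  assumes D: "st_connected V E s t"
    and S: "S \<subseteq> V - {s, t}" "2 \<le> card S" "card (entry E S) = 2" "entry E S \<noteq> {s, t}"
    and smax: "\<And>A. A \<subseteq> V - {s, t} \<Longrightarrow> S \<subset> A \<Longrightarrow> entry E A = entry E S \<Longrightarrow> False"
    and IH: "\<And>V' E' s' t'. card (V' :: 'v set) < card V \<Longrightarrow> card E' \<le> card E \<Longrightarrow> st_connected V' (E' :: ('v \<times> 'v) set) s' t' \<Longrightarrow> \<exists>L. st_order V' E' s' t' L"
  shows "\<exists>L. st_order V E s t L"
proof -
  note finE = st_connected_finite[OF D]
  have V: "finite V" "s \<in> V" "t \<in> V" "s \<noteq> t" "E \<subseteq> V \<times> (V - {s, t})" "irrefl E"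
    and ent: "\<And>A. A \<subseteq> V - {s, t} \<Longrightarrow> A \<noteq> {} \<Longrightarrow> card (entry E A) \<ge> 2"
    using D unfolding st_connected_def by blast+
  have finS: "finite S" using S(1) V(1) by (meson finite_Diff finite_subset)
  obtain c where c: "c \<in> S" using S(2) by fastforce
  define p where "p = (\<lambda>x. if x \<in> S then c else x)"
  define V1 where "V1 = V - S \<union> {c}"
  define E1 where "E1 = quot p E"
  have cI: "c \<in> V - {s, t}" using c S(1) by blast
  have V1V: "V1 \<subseteq> V" "card V1 < card V"
  proof -
    show "V1 \<subseteq> V" using cI unfolding V1_def by blast
    obtain d where "d \<in> S" "d \<noteq> c" using S(2) c
      by (metis card_le_Suc0_iff_eq finS not_less_eq_eq numeral_2_eq_2)
    then have "V1 \<subset> V" using S(1) cI unfolding V1_def by blast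
    then show "card V1 < card V" using V(1) by (rule psubset_card_mono[rotated])
  qed
  have vim_in: "p -` A = A \<union> S" if "c \<in> A" for A using that c unfolding p_def by (auto split: if_splits)
  have vim_out: "p -` A = A - S" if "c \<notin> A" for A using that c unfolding p_def by (auto split: if_splits)
  have "st_connected V1 E1 s t"
  proof (rule st_connectedI)
    show "finite V1" using V1V(1) V(1) finite_subset by blast
    show "s \<in> V1" "t \<in> V1" "s \<noteq> t" using V S(1) unfolding V1_def by auto
    show "E1 \<subseteq> V1 \<times> (V1 - {s, t})" using V(5) S(1) c unfolding E1_def quot_def p_def V1_def by auto
    show "irrefl E1" unfolding E1_def quot_def irrefl_def by auto
    fix A assume A: "A \<subseteq> V1 - {s, t}" "A \<noteq> {}"
    have AI: "A \<subseteq> V - {s, t}" using A V1V by blast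
    show "2 \<le> card (entry E1 A)"
    proof (cases "c \<in> A")
      case True
      have "card (p ` entry E (A \<union> S)) = card (entry E (A \<union> S))"
        by (rule card_image) (auto simp: inj_on_def entry_def p_def)
      then show ?thesis using ent[of "A \<union> S"] A AI S(1) vim_in[OF True] unfolding E1_def entry_quot by auto
    next
      case False
      then have AS: "A - S = A" using A(1) unfolding V1_def by blast
      have eq: "entry E1 A = p ` entry E A" unfolding E1_def entry_quot vim_out[OF False] AS ..
      have fin: "finite (entry E1 A)" unfolding eq using finE finite_entry by blast
      have two: "2 \<le> card (entry E A)" using ent AI A(2) by blast
      show ?thesis
      proof (cases "entry E A \<inter> S = {}")
        case True
        then have "p ` entry E A = entry E A" unfolding p_def by force
        then show ?thesis using eq two by simp
      next
        case False
        then obtain a where a: "a \<in> entry E A" "a \<in> S" by blast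
        show ?thesis
        proof (cases "entry E A \<subseteq> S")
          case True
          \<comment> \<open>The dangerous case: all vertices entering \<open>A\<close> are merged
            into \<open>c\<close>. Then \<open>A\<close> could have been added to
            \<open>S\<close>.\<close>
          have sub: "entry E (A \<union> S) \<subseteq> entry E S" using True unfolding entry_def by blast
          have "2 \<le> card (entry E (A \<union> S))" using ent[of "A \<union> S"] AI S(1) A(2) by blast
          then have "entry E (A \<union> S) = entry E S"
            using sub S(3) finite_entry[OF finE] by (metis card_seteq)
          moreover have "S \<subset> A \<union> S" using AS A(2) by blast
          ultimately show ?thesis using smax[of "A \<union> S"] AI S(1) by blast
        next
          case False
          then obtain b where b: "b \<in> entry E A" "b \<notin> S" by blast
          have "{p a, p b} \<subseteq> entry E1 A" unfolding eq using a b by blast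
          moreover have "p a \<noteq> p b" using a b c unfolding p_def by auto
          ultimately show ?thesis using fin card_mono[of "entry E1 A" "{p a, p b}"] by simp
        qed
      qed
    qed
  qed
  then obtain L1 where L1: "st_order V1 E1 s t L1"
    using IH[OF V1V(2)] card_quot[OF finE] unfolding E1_def by blast
  have cI1: "c \<in> V1 - {s, t}" using cI unfolding V1_def by blast
  have pS: "\<And>x. x \<in> S \<Longrightarrow> p x = c" and pnS: "\<And>x. x \<notin> S \<Longrightarrow> p x = x" unfolding p_def by auto
  have E1c: "x \<in> entry E S" if xc: "(x, c) \<in> E1" for x
  proof -
    obtain u v where uv: "(u, v) \<in> E" "p u = x" "p v = c" "x \<noteq> c" using xc unfolding E1_def quot_def by blast
    then have "v \<in> S" "u \<notin> S" using c unfolding p_def by (auto split: if_splits)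
    then show ?thesis using uv pnS unfolding entry_def by auto
  qed
  obtain a b where ab: "(a, c) \<in> E1" "(a, c) \<in> L1" "(b, c) \<in> E1" "(c, b) \<in> L1"
    using L1 cI1 unfolding st_order_def by blast
  have T1: "trans L1" "irrefl L1" "total_on V1 L1" using L1 unfolding st_order_def by blast+
  then have "a \<noteq> b" using ab unfolding irrefl_def by (metis transD)
  then have entS: "entry E S = {a, b}"
    using E1c ab S(3) finite_entry[OF finE] card_seteq[of "entry E S" "{a, b}"] by auto
  define V2 where "V2 = S \<union> {a, b}"
  define E2 where "E2 = E \<inter> UNIV \<times> S"
  have ab_nS: "a \<notin> S" "b \<notin> S" using entS unfolding entry_def by auto
  have entV: "entry E S \<subseteq> V" using V(5) unfolding entry_def by blast
  have V2V: "V2 \<subseteq> V" using entV entS S(1) unfolding V2_def by blast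
  have "st_connected V2 E2 a b"
  proof (rule st_connectedI)
    show "finite V2" using V2V V(1) finite_subset by blast
    show "a \<in> V2" "b \<in> V2" "a \<noteq> b" using \<open>a \<noteq> b\<close> unfolding V2_def by auto
    show "E2 \<subseteq> V2 \<times> (V2 - {a, b})"
    proof
      fix e assume "e \<in> E2"
      then obtain x y where xy: "e = (x, y)" "(x, y) \<in> E" "y \<in> S" unfolding E2_def by auto
      have "x \<in> S \<union> entry E S" using xy unfolding entry_def by blast
      then show "e \<in> V2 \<times> (V2 - {a, b})" using xy entS ab_nS unfolding V2_def by auto
    qed
    show "irrefl E2" using V(6) unfolding E2_def irrefl_def by auto
    fix A assume A: "A \<subseteq> V2 - {a, b}" "A \<noteq> {}"
    then have "A \<subseteq> S" unfolding V2_def by blast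
    then have "entry E2 A = entry E A" unfolding entry_def E2_def by blast
    then show "2 \<le> card (entry E2 A)" using ent[of A] \<open>A \<subseteq> S\<close> S(1) A(2) by auto
  qed
  moreover have "card V2 < card V"
  proof -
    have "{a, b} \<noteq> {s, t}" using S(4) entS by simp
    then have "\<not> {s, t} \<subseteq> {a, b}" using V(4) by auto
    then have "V2 \<noteq> V" using S(1) V(2,3) unfolding V2_def by blast
    then show ?thesis using V2V V(1) by (metis psubsetI psubset_card_mono)
  qed
  moreover have "card E2 \<le> card E" unfolding E2_def using finE by (simp add: card_mono)
  ultimately obtain L2 where L2: "st_order V2 E2 a b L2" using IH by blast
  have T2: "trans L2" "irrefl L2" "total_on V2 L2" using L2 unfolding st_order_def by blast+
  have asym2: "(x, y) \<in> L2 \<Longrightarrow> (y, x) \<notin> L2" for x y using T2 unfolding irrefl_def by (meson transD)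
  let ?L = "lex_over p L1 L2"
  have "st_order V E s t ?L"
  proof (rule st_orderI)
    show "trans ?L" "irrefl ?L" using T1 T2 trans_lex_over irrefl_lex_over by blast+
    show "total_on V ?L"
    proof (rule total_on_lex_over[OF T1(3)])
      show "p ` V \<subseteq> V1" unfolding p_def V1_def by auto
      fix x y assume "x \<in> V" "y \<in> V" "x \<noteq> y" "p x = p y"
      then have "x \<in> S" "y \<in> S" using c unfolding p_def by (auto split: if_splits)
      then show "(x, y) \<in> L2 \<or> (y, x) \<in> L2" using T2(3) \<open>x \<noteq> y\<close> unfolding V2_def total_on_def by blast
    qed
    have ps: "p s = s" "p t = t" using pnS S(1) by blast+
    show "(s, t) \<in> ?L" using L1 ps unfolding lex_over_def st_order_def by auto
    fix v assume v: "v \<in> V - {s, t}"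
    show "(s, v) \<in> ?L \<and> (v, t) \<in> ?L \<and> (\<exists>u. (u, v) \<in> E \<and> (u, v) \<in> ?L) \<and> (\<exists>w. (w, v) \<in> E \<and> (v, w) \<in> ?L)"
    proof (cases "v \<in> S")
      case True
      have pv: "p v = c" using pS True .
      have "v \<in> V2 - {a, b}" using True ab_nS unfolding V2_def by auto
      then obtain u w where uw: "(a, v) \<in> L2" "(v, b) \<in> L2" "(u, v) \<in> E2" "(u, v) \<in> L2" "(w, v) \<in> E2" "(v, w) \<in> L2"
        using L2 unfolding st_order_def by blast
      have "u \<in> S \<union> entry E S" "w \<in> S \<union> entry E S" using uw True unfolding E2_def entry_def by blast+
      \<comment> \<open>\<open>b\<close> is last in \<open>L2\<close>, so an earlier in-neighbour is
        never \<open>b\<close>; dually for \<open>a\<close>. Comparisons inside \<open>S\<close>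
        come from \<open>L2\<close>, those with \<open>a\<close> and \<open>b\<close> from
        \<open>L1\<close>.\<close>
      then have "u = a \<or> u \<in> S" "w = b \<or> w \<in> S" using entS uw(1-4,6) asym2[of a v] asym2[of v b] by auto
      then have "(u, v) \<in> ?L" "(v, w) \<in> ?L" using uw ab pv pS pnS ab_nS unfolding lex_over_def by auto
      moreover have "(s, v) \<in> ?L" "(v, t) \<in> ?L" using L1 cI1 pv ps unfolding lex_over_def st_order_def by auto
      ultimately show ?thesis using uw unfolding E2_def by blast
    next
      case False
      then have pv: "p v = v" using pnS by blast
      have v1: "v \<in> V1 - {s, t}" using v False unfolding V1_def by blast
      then obtain u w where uw: "(s, v) \<in> L1" "(v, t) \<in> L1" "(u, v) \<in> E1" "(u, v) \<in> L1" "(w, v) \<in> E1" "(v, w) \<in> L1"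
        using L1 unfolding st_order_def by blast
      have pre: "\<exists>u'. (u', v) \<in> E \<and> p u' = u" if "(u, v) \<in> E1" for u
        using that False c unfolding E1_def quot_def p_def by (auto split: if_splits)
      obtain u' w' where "(u', v) \<in> E" "p u' = u" "(w', v) \<in> E" "p w' = w" using pre uw by blast
      then show ?thesis using uw pv ps unfolding lex_over_def by auto
    qed
  qed
  then show ?thesis by blast
qed

text \<open>Only the out-neighbours of \<open>v\<close> notice its removal. If there are none,
  \<open>v\<close> is deleted and later placed between its two in-neighbours. Otherwise it is
  contracted into \<open>w\<close>; when it is put back, only \<open>v\<close> and \<open>w\<close>
  need attention, and \<open>w\<close> has just one in-neighbour \<open>x\<close> besides
  \<open>v\<close>.\<close>

lemma st_order_small_out_degree:
  fixes V :: "'v set"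
  assumes D: "st_connected V E s t"
    and v: "v \<in> V - {s, t}" "card (entry E {v}) = 2" "E `` {v} \<subseteq> {w}"
    and w: "E `` {v} = {} \<or> card (entry E {w}) = 2"
    and IH: "\<And>V' E' s' t'. card (V' :: 'v set) < card V \<Longrightarrow> card E' \<le> card E \<Longrightarrow> st_connected V' (E' :: ('v \<times> 'v) set) s' t' \<Longrightarrow> \<exists>L. st_order V' E' s' t' L"
  shows "\<exists>L. st_order V E s t L"
proof -
  note finE = st_connected_finite[OF D]
  have V: "finite V" "s \<in> V" "t \<in> V" "s \<noteq> t" "E \<subseteq> V \<times> (V - {s, t})" "irrefl E"
    and ent: "\<And>A. A \<subseteq> V - {s, t} \<Longrightarrow> A \<noteq> {} \<Longrightarrow> card (entry E A) \<ge> 2"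
    using D unfolding st_connected_def by blast+
  define V1 where "V1 = V - {v}"
  have V1: "finite V1" "s \<in> V1" "t \<in> V1" "card V1 < card V" "v \<notin> V1" "V = insert v V1"
    using V v card_Diff1_less[of V v] unfolding V1_def by (auto simp del: card_Diff_insert)
  obtain y1 y2 where y: "entry E {v} = {y1, y2}" "y1 \<noteq> y2" using v(2) by (meson card_2_iff)
  have yE: "(y1, v) \<in> E" "(y2, v) \<in> E" "y1 \<noteq> v" "y2 \<noteq> v" using y(1) unfolding entry_def by blast+
  have inv: "x = y1 \<or> x = y2" if "(x, v) \<in> E" for x
    using that y(1) V(6) unfolding entry_def irrefl_def by blast
  have yV: "y1 \<in> V1" "y2 \<in> V1" using yE V(5) unfolding V1_def by blast+
  \<comment> \<open>Since \<open>v\<close> lies between two elements of \<open>V1\<close>, it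
    respects the end positions of \<open>s\<close> and \<open>t\<close>; only the in-neighbours of
    the other vertices remain to be checked.\<close>
  have finish: "\<exists>L. st_order V E s t L"
    if L1: "st_order V1 E1 s t L1" and M: "trans M" "irrefl M" "total_on (insert v V1) M"
    "\<And>a b. a \<in> V1 \<Longrightarrow> b \<in> V1 \<Longrightarrow> (a, b) \<in> M \<longleftrightarrow> (a, b) \<in> L1"
    and My: "(y1, v) \<in> M \<and> (v, y2) \<in> M \<or> (y2, v) \<in> M \<and> (v, y1) \<in> M"
    and nb: "\<And>z. z \<in> V1 - {s, t} \<Longrightarrow> (\<exists>u. (u, z) \<in> E \<and> (u, z) \<in> M) \<and> (\<exists>u. (u, z) \<in> E \<and> (z, u) \<in> M)" for E1 L1 M
  proof -
    have s_le: "x = s \<or> (s, x) \<in> M" and le_t: "x = t \<or> (x, t) \<in> M" if "x \<in> V1" for x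
      using L1 that V1 M(4) unfolding st_order_def by (metis Diff_iff empty_iff insert_iff)+
    obtain a b where ab: "a \<in> V1" "b \<in> V1" "(a, v) \<in> M" "(v, b) \<in> M" "(a, v) \<in> E" "(b, v) \<in> E"
      using My yV yE by blast
    have "(s, v) \<in> M" "(v, t) \<in> M" using s_le[OF ab(1)] le_t[OF ab(2)] ab transD[OF M(1)] by blast+
    have "st_order V E s t M"
    proof (rule st_orderI[OF M(1,2)])
      show "total_on V M" using M(3) V1 by simp
      show "(s, t) \<in> M" using L1 M(4) V1 unfolding st_order_def by blast
      fix z assume z: "z \<in> V - {s, t}"
      show "(s, z) \<in> M \<and> (z, t) \<in> M \<and> (\<exists>u. (u, z) \<in> E \<and> (u, z) \<in> M) \<and> (\<exists>w. (w, z) \<in> E \<and> (z, w) \<in> M)"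
      proof (cases "z = v")
        case True then show ?thesis using ab \<open>(s, v) \<in> M\<close> \<open>(v, t) \<in> M\<close> by blast
      next
        case False
        then have "z \<in> V1 - {s, t}" using z V1_def by blast
        then show ?thesis using nb[of z] s_le[of z] le_t[of z] z by blast
      qed
    qed
    then show ?thesis by blast
  qed
  show ?thesis
  proof (cases "E `` {v} = {}")
    case True
    define E1 where "E1 = E \<inter> UNIV \<times> (- {v})"
    have "st_connected V1 E1 s t"
    proof (rule st_connectedI[OF V1(1-3) V(4)])
      show "E1 \<subseteq> V1 \<times> (V1 - {s, t})" using V(5) True unfolding E1_def V1_def by auto
      show "irrefl E1" using V(6) unfolding E1_def irrefl_def by auto
      fix A assume A: "A \<subseteq> V1 - {s, t}" "A \<noteq> {}"
      then have "entry E1 A = entry E A" unfolding entry_def E1_def V1_def by blast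
      then show "2 \<le> card (entry E1 A)" using ent[of A] A V1 by auto
    qed
    moreover have "card E1 \<le> card E" unfolding E1_def using finE by (simp add: card_mono)
    ultimately obtain L1 where L1: "st_order V1 E1 s t L1" using IH V1(4) by blast
    then have T1: "trans L1" "irrefl L1" "total_on V1 L1" unfolding st_order_def by blast+
    obtain a b where ab: "{a, b} = {y1, y2}" "(a, b) \<in> L1"
      using yV y(2) T1(3) unfolding total_on_def by blast
    then have abV: "a \<in> V1" "b \<in> V1" using yV by (auto simp: doubleton_eq_iff)
    obtain M where M: "trans M" "irrefl M" "total_on (insert v V1) M"
      "\<And>a b. a \<in> V1 \<Longrightarrow> b \<in> V1 \<Longrightarrow> (a, b) \<in> M \<longleftrightarrow> (a, b) \<in> L1"
      "(a, v) \<in> M" "\<And>z. z \<in> V1 \<Longrightarrow> (a, z) \<in> L1 \<Longrightarrow> (v, z) \<in> M"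
      using insert_after[OF T1 abV(1) V1(5)] by blast
    have "(y1, v) \<in> M \<and> (v, y2) \<in> M \<or> (y2, v) \<in> M \<and> (v, y1) \<in> M"
      using M(5) M(6)[OF abV(2)] ab by (auto simp: doubleton_eq_iff)
    moreover have "(\<exists>u. (u, z) \<in> E \<and> (u, z) \<in> M) \<and> (\<exists>u. (u, z) \<in> E \<and> (z, u) \<in> M)" if z: "z \<in> V1 - {s, t}" for z
    proof -
      obtain u u' where "(u, z) \<in> E1" "(u, z) \<in> L1" "(u', z) \<in> E1" "(z, u') \<in> L1"
        using L1 z unfolding st_order_def by blast
      moreover have "u \<in> V1" "u' \<in> V1" using calculation V(5) True unfolding E1_def V1_def by blast+
      ultimately show ?thesis using M(4) z unfolding E1_def by blast
    qed
    ultimately show ?thesis using finish[OF L1 M(1-4)] by blast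
  next
    case False
    then have vw: "(v, w) \<in> E" and only_w: "\<And>z. (v, z) \<in> E \<Longrightarrow> z = w" using v(3) by auto
    have wv: "w \<noteq> v" and wI: "w \<in> V - {s, t}" using vw V(5,6) unfolding irrefl_def by auto
    obtain x where x: "entry E {w} = {v, x}" "x \<noteq> v"
    proof -
      have "v \<in> entry E {w}" using vw wv unfolding entry_def by blast
      moreover have "card (entry E {w}) = 2" using w False by blast
      ultimately show thesis using that by (metis card_2_iff doubleton_eq_iff insert_iff singletonD)
    qed
    have xE: "(x, w) \<in> E" "x \<noteq> w" using x unfolding entry_def by blast+
    have inw: "z = v \<or> z = x" if "(z, w) \<in> E" for z
      using that x V(6) unfolding entry_def irrefl_def by blast
    define p where "p = id(v := w)"
    define E1 where "E1 = quot p E"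
    have "st_connected V1 E1 s t"
    proof (rule st_connectedI[OF V1(1-3) V(4)])
      show "E1 \<subseteq> V1 \<times> (V1 - {s, t})" using V(5) wI wv unfolding E1_def V1_def quot_def p_def by auto
      show "irrefl E1" unfolding E1_def quot_def irrefl_def by auto
      fix A assume A: "A \<subseteq> V1 - {s, t}" "A \<noteq> {}"
      show "2 \<le> card (entry E1 A)"
      proof (cases "w \<in> A")
        case True
        then have vim: "p -` A = insert v A" using A unfolding p_def by (auto split: if_splits)
        have "card (p ` entry E (insert v A)) = card (entry E (insert v A))"
          by (rule card_image) (use True in \<open>auto simp: inj_on_def entry_def p_def\<close>)
        then show ?thesis using ent[of "insert v A"] A v V1 unfolding E1_def entry_quot vim by auto
      next
        case False
        then have vim: "p -` A = A" using A unfolding p_def V1_def by (auto split: if_splits)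
        have "v \<notin> entry E A" using only_w False unfolding entry_def by blast
        then have "p ` entry E A = entry E A" unfolding p_def by force
        then show ?thesis using ent[of A] A V1 unfolding E1_def entry_quot vim by auto
      qed
    qed
    then obtain L1 where L1: "st_order V1 E1 s t L1"
      using IH[OF V1(4)] card_quot[OF finE] unfolding E1_def by blast
    then have T1: "trans L1" "irrefl L1" "total_on V1 L1" unfolding st_order_def by blast+
    have w1: "w \<in> V1 - {s, t}" using wI wv unfolding V1_def by blast
    then have w1': "w \<in> V1" by blast
    have xV: "x \<in> V1" using xE x V(5) unfolding V1_def by blast
    obtain u1 u2 where u: "(u1, w) \<in> E1" "(u1, w) \<in> L1" "(u2, w) \<in> E1" "(w, u2) \<in> L1"
      using L1 w1 unfolding st_order_def by blast
    have in1: "u \<in> {x, y1, y2}" if "(u, w) \<in> E1" for u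
      using that inv inw unfolding E1_def quot_def p_def by (auto split: if_splits)
    obtain M where M: "trans M" "irrefl M" "total_on (insert v V1) M"
      "\<And>a b. a \<in> V1 \<Longrightarrow> b \<in> V1 \<Longrightarrow> (a, b) \<in> M \<longleftrightarrow> (a, b) \<in> L1"
      "(x, w) \<in> M \<and> (w, v) \<in> M \<or> (v, w) \<in> M \<and> (w, x) \<in> M"
      "(y1, v) \<in> M \<and> (v, y2) \<in> M \<or> (y2, v) \<in> M \<and> (v, y1) \<in> M"
      by (fact insert_beside[OF T1 V1(5) w1' xV xE(2) yV y(2) in1[OF u(1)] in1[OF u(3)] u(2,4)])
    moreover have "(\<exists>u. (u, z) \<in> E \<and> (u, z) \<in> M) \<and> (\<exists>u. (u, z) \<in> E \<and> (z, u) \<in> M)" if z: "z \<in> V1 - {s, t}" for z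
    proof (cases "z = w")
      case True then show ?thesis using M(5) vw xE by blast
    next
      case False
      have pre: "(u, z) \<in> E \<and> u \<in> V1" if uz: "(u, z) \<in> E1" for u
      proof -
        obtain u' z' where uz': "(u', z') \<in> E" "p u' = u" "p z' = z" using uz unfolding E1_def quot_def by blast
        then have "z' = z" using False unfolding p_def by (auto split: if_splits)
        moreover have "u' \<noteq> v" using only_w uz'(1) \<open>z' = z\<close> False by blast
        ultimately show ?thesis using uz' V(5) unfolding p_def V1_def by auto
      qed
      obtain u u' where "(u, z) \<in> E1" "(u, z) \<in> L1" "(u', z) \<in> E1" "(z, u') \<in> L1"
        using L1 z unfolding st_order_def by blast
      then show ?thesis using M(4) z pre by blast
    qed
    ultimately show ?thesis using finish[OF L1] by blast
  qed
qed

text \<open>Counting arcs by heads gives twice the number of inner vertices. If all inner vertices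
  had two out-neighbours, counting by tails would give at least 2 more, because the set of inner
  vertices is entered from both \<open>s\<close> and \<open>t\<close>.\<close>

lemma small_out_degree_exists:
  assumes D: "st_connected V E s t" and ne: "V - {s, t} \<noteq> {}"
    and two: "\<And>v. v \<in> V - {s, t} \<Longrightarrow> card (entry E {v}) = 2"
  obtains v where "v \<in> V - {s, t}" "card (E `` {v}) \<le> 1"
proof (rule ccontr)
  assume "\<not> thesis"
  then have big: "\<And>v. v \<in> V - {s, t} \<Longrightarrow> 2 \<le> card (E `` {v})" using that by force
  note finE = st_connected_finite[OF D]
  have V: "finite V" "s \<in> V" "t \<in> V" "s \<noteq> t" "E \<subseteq> V \<times> (V - {s, t})" "irrefl E"
    and ent: "\<And>A. A \<subseteq> V - {s, t} \<Longrightarrow> A \<noteq> {} \<Longrightarrow> card (entry E A) \<ge> 2"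
    using D unfolding st_connected_def by blast+
  let ?I = "V - {s, t}"
  have "entry E ?I \<subseteq> {s, t}" using V(5) unfolding entry_def by blast
  moreover have "2 \<le> card (entry E ?I)" using ent ne by blast
  ultimately have "entry E ?I = {s, t}" using V(4) by (intro card_seteq) auto
  then have st1: "1 \<le> card (E `` {s})" "1 \<le> card (E `` {t})"
    using finE by (auto simp: entry_def Suc_le_eq card_gt_0_iff finite_Image)
  have "E = Sigma V (\<lambda>u. E `` {u})" using V(5) by auto
  then have "card E = (\<Sum>u\<in>V. card (E `` {u}))"
    using V(1) finE by (metis card_SigmaI finite_Image)
  also have "\<dots> = (\<Sum>u\<in>{s, t}. card (E `` {u})) + (\<Sum>u\<in>?I. card (E `` {u}))"
    using V(1-3) sum.subset_diff[of "{s, t}" V "\<lambda>u. card (E `` {u})"] by (simp only: add.commute) auto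
  finally have "card E = (\<Sum>u\<in>{s, t}. card (E `` {u})) + (\<Sum>u\<in>?I. card (E `` {u}))" .
  moreover have "2 \<le> (\<Sum>u\<in>{s, t}. card (E `` {u}))" using st1 V(4) by simp
  moreover have "card ?I * 2 \<le> (\<Sum>u\<in>?I. card (E `` {u}))" using sum_bounded_below[of ?I 2 "\<lambda>u. card (E `` {u})"] big by simp
  ultimately have low: "2 + 2 * card ?I \<le> card E" by linarith
  have "v \<in> ?I \<and> u \<noteq> v" if "(u, v) \<in> E" for u v using that V(5,6) by (auto simp: irrefl_def)
  then have "E\<inverse> = Sigma ?I (\<lambda>v. entry E {v})" unfolding entry_def by auto
  moreover have "card (Sigma ?I (\<lambda>v. entry E {v})) = (\<Sum>v\<in>?I. card (entry E {v}))"
    using V(1) finE finite_entry by (intro card_SigmaI) auto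
  ultimately have "card (E\<inverse>) = 2 * card ?I" using two by (simp del: card_inverse)
  then show False using low by simp
qed

text \<open>
  A set entered from only two vertices is contracted and ordered separately. Without such sets, surplus
  arcs can be deleted until all in-degrees are 2; then some vertex has at most one out-neighbour, into
  which it can be contracted.
\<close>

theorem st_order_exists: "st_connected V E s t \<Longrightarrow> \<exists>L. st_order V (E :: ('v \<times> 'v) set) s t L"
proof (induction "card V + card E" arbitrary: V E s t rule: less_induct)
  case less
  note D = less.prems
  note finE = st_connected_finite[OF D]
  have V: "finite V" "s \<in> V" "t \<in> V" "s \<noteq> t" "E \<subseteq> V \<times> (V - {s, t})" "irrefl E"
    and ent: "\<And>A. A \<subseteq> V - {s, t} \<Longrightarrow> A \<noteq> {} \<Longrightarrow> card (entry E A) \<ge> 2"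
    using D unfolding st_connected_def by blast+
  have IH: "card V' < card V \<Longrightarrow> card E' \<le> card E \<Longrightarrow> st_connected V' E' s' t' \<Longrightarrow> \<exists>L. st_order V' E' s' t' L"
    for V' :: "'v set" and E' s' t' using less.hyps[of V' E'] by (meson add_less_le_mono)
  let ?I = "V - {s, t}"
  let ?tight = "\<lambda>S. S \<subseteq> ?I \<and> 2 \<le> card S \<and> card (entry E S) = 2 \<and> entry E S \<noteq> {s, t}"
  consider (tight) "\<exists>S. ?tight S" | (empty) "?I = {}"
    | (delete) v where "\<nexists>S. ?tight S" "v \<in> ?I" "3 \<le> card (entry E {v})"
    | (two) "?I \<noteq> {}" "\<And>v. v \<in> ?I \<Longrightarrow> card (entry E {v}) = 2"
  proof -
    have "card (entry E {v}) = 2 \<or> 3 \<le> card (entry E {v})" if "v \<in> ?I" for v using ent[of "{v}"] that by fastforce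
    then show ?thesis using that by metis
  qed
  then show ?case
  proof cases
    case tight
    have "finite {S. ?tight S}" by (rule finite_subset[of _ "Pow V"]) (use V(1) in auto)
    then have "\<exists>S \<in> {S. ?tight S}. \<forall>A \<in> {S. ?tight S}. S \<subseteq> A \<longrightarrow> S = A"
      using tight by (intro finite_has_maximal) blast+
    then obtain S where S: "?tight S" and m: "\<And>A. ?tight A \<Longrightarrow> S \<subseteq> A \<Longrightarrow> A = S"
      unfolding mem_Collect_eq Ball_def Bex_def by metis
    show ?thesis
    proof (rule st_order_tight_set[OF D])
      show "S \<subseteq> ?I" "2 \<le> card S" "card (entry E S) = 2" "entry E S \<noteq> {s, t}" using S by auto
      show False if "A \<subseteq> ?I" "S \<subset> A" "entry E A = entry E S" for A
      proof -
        have "card S \<le> card A" using that V(1) by (intro card_mono) (auto intro: finite_subset)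
        then have "?tight A" using S that by simp
        then show False using m that by blast
      qed
    qed (use IH in blast)
  next
    case empty
    then have "V = {s, t}" using V by blast
    then have "st_order V E s t {(s, t)}"
      using V(4) by (auto intro!: st_orderI simp: trans_def irrefl_def total_on_def)
    then show ?thesis by blast
  next
    case (delete v)
    \<comment> \<open>A set entered from exactly \<open>s\<close> and \<open>t\<close> loses nothing
      when the deleted arc starts elsewhere. Any other set that contains \<open>v\<close> has at
      least three entry vertices, by the case assumption if it is \<open>{v}\<close> and otherwise
      because it is not tight.\<close>
    have "\<exists>u \<in> entry E {v}. u \<notin> {s, t}"
    proof (rule ccontr)
      assume "\<not> ?thesis"
      then have "entry E {v} \<subseteq> {s, t}" by blast
      then have "card (entry E {v}) \<le> card {s, t}" by (intro card_mono) auto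
      then show False using delete V(4) by simp
    qed
    then obtain u where u: "u \<notin> {s, t}" "(u, v) \<in> E" unfolding entry_def by blast
    let ?E = "E - {(u, v)}"
    have "st_connected V ?E s t"
    proof (rule st_connectedI[OF V(1-4)])
      show "?E \<subseteq> V \<times> ?I" "irrefl ?E" using V(5,6) unfolding irrefl_def by auto
      fix A assume A: "A \<subseteq> ?I" "A \<noteq> {}"
      have sub: "entry E A - {u} \<subseteq> entry ?E A" unfolding entry_def by blast
      have fin: "finite (entry ?E A)" using finE finite_entry by (metis finite_Diff)
      have three: "2 \<le> card (entry ?E A)" if "3 \<le> card (entry E A)"
      proof -
        have "card (entry E A) - 1 \<le> card (entry E A - {u})" by (simp add: card_Diff_singleton_if)
        also have "\<dots> \<le> card (entry ?E A)" by (rule card_mono[OF fin sub])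
        finally show ?thesis using that by simp
      qed
      have same: "2 \<le> card (entry ?E A)" if "u \<notin> entry E A \<or> v \<notin> A"
      proof -
        have "entry E A \<subseteq> entry ?E A" using that unfolding entry_def by blast
        then show ?thesis using card_mono[OF fin] ent[OF A] by (meson le_trans)
      qed
      have "finite A" using A(1) V(1) finite_subset by blast
      show "2 \<le> card (entry ?E A)"
      proof (cases "A = {v} \<or> v \<notin> A")
        case True then show ?thesis using three same delete by blast
      next
        case False
        have "2 \<le> card A"
        proof (rule ccontr)
          assume "\<not> 2 \<le> card A"
          then have "card A \<le> Suc 0" by simp
          then show False using False \<open>finite A\<close> by (auto simp: card_le_Suc0_iff_eq)
        qed
        then have "3 \<le> card (entry E A) \<or> entry E A = {s, t}"
          using delete(1) A(1) ent[OF A] by (metis One_nat_def Suc_1 le_antisym not_less_eq_eq numeral_3_eq_3)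
        then show ?thesis using three same u(1) by blast
      qed
    qed
    moreover have "card ?E < card E" using u finE by (meson card_Diff1_less)
    ultimately obtain L where "st_order V ?E s t L" using less.hyps by (meson add_less_cancel_left)
    then have "st_order V E s t L" unfolding st_order_def by blast
    then show ?thesis by blast
  next
    case two
    obtain v where v: "v \<in> ?I" "card (E `` {v}) \<le> 1"
      using small_out_degree_exists[OF D two] by blast
    have "finite (E `` {v})" using finE by (simp add: finite_Image)
    then obtain w where w: "E `` {v} \<subseteq> {w}"
      using v(2) by (cases "E `` {v} = {}") (auto simp: card_le_Suc0_iff_eq)
    then have "E `` {v} = {} \<or> card (entry E {w}) = 2" using two(2) V(5) by blast
    then show ?thesis using st_order_small_out_degree[OF D v(1) two(2)[OF v(1)] w _ IH] by blast
  qed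
qed

section \<open>Splitting at cut-vertices\<close>

definition rooted :: "'v set \<Rightarrow> ('v \<times> 'v) set \<Rightarrow> 'v \<Rightarrow> bool" where
  "rooted V E r \<longleftrightarrow> finite V \<and> r \<in> V \<and> E \<subseteq> V \<times> (V - {r}) \<and> irrefl E \<and>
     (\<forall>A \<subseteq> V - {r}. A \<noteq> {} \<longrightarrow> entry E A \<noteq> {})"

text \<open>A cut-vertex in terms of sets: once \<open>c\<close> is removed, nothing leads into
  \<open>A\<close>.\<close>

definition separator :: "'v set \<Rightarrow> ('v \<times> 'v) set \<Rightarrow> 'v \<Rightarrow> 'v \<Rightarrow> bool" where
  "separator V E r c \<longleftrightarrow> c \<noteq> r \<and> (\<exists>A \<subseteq> V - {r}. A \<noteq> {} \<and> entry E A = {c})"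

text \<open>Without cut-vertices \<open>M\<close> will be the reverse of \<open>L\<close>, except
  that the root comes first in both. A cut-vertex necessarily precedes in both relations every
  vertex that it cuts off, so the last condition exempts it.\<close>

definition order_pair :: "'v set \<Rightarrow> ('v \<times> 'v) set \<Rightarrow> 'v \<Rightarrow> ('v \<times> 'v) set \<Rightarrow> ('v \<times> 'v) set \<Rightarrow> bool" where
  "order_pair V E r L M \<longleftrightarrow> trans L \<and> irrefl L \<and> trans M \<and> irrefl M \<and>
     (\<forall>v \<in> V - {r}. (\<exists>u. (u, v) \<in> E \<and> (u, v) \<in> L) \<and> (\<exists>u. (u, v) \<in> E \<and> (u, v) \<in> M)) \<and>
     (\<forall>x \<in> V - {r}. \<not> separator V E r x \<longrightarrow> (\<forall>y \<in> V. \<not> ((x, y) \<in> L \<and> (x, y) \<in> M)))"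

lemma rootedI:
  assumes "finite V" "r \<in> V" "E \<subseteq> V \<times> (V - {r})" "irrefl E"
    "\<And>A. A \<subseteq> V - {r} \<Longrightarrow> A \<noteq> {} \<Longrightarrow> entry E A \<noteq> {}"
  shows "rooted V E r"
  using assms unfolding rooted_def by blast

lemma rootedD:
  assumes "rooted V E r"
  shows "finite V" "r \<in> V" "E \<subseteq> V \<times> (V - {r})" "irrefl E"
    "\<And>A. A \<subseteq> V - {r} \<Longrightarrow> A \<noteq> {} \<Longrightarrow> entry E A \<noteq> {}" "finite E"
  using assms unfolding rooted_def by (blast, blast, blast, blast, blast, meson finite_Diff finite_SigmaI finite_subset)

lemma separatorI: "c \<noteq> r \<Longrightarrow> A \<subseteq> V - {r} \<Longrightarrow> A \<noteq> {} \<Longrightarrow> entry E A = {c} \<Longrightarrow> separator V E r c"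
  unfolding separator_def by blast

lemma order_pairI:
  assumes "trans L" "irrefl L" "trans M" "irrefl M"
    "\<And>v. v \<in> V - {r} \<Longrightarrow> (\<exists>u. (u, v) \<in> E \<and> (u, v) \<in> L) \<and> (\<exists>u. (u, v) \<in> E \<and> (u, v) \<in> M)"
    "\<And>x y. x \<in> V - {r} \<Longrightarrow> \<not> separator V E r x \<Longrightarrow> y \<in> V \<Longrightarrow> (x, y) \<in> L \<Longrightarrow> (x, y) \<in> M \<Longrightarrow> False"
  shows "order_pair V E r L M"
  using assms unfolding order_pair_def by blast

text \<open>The root is doubled, the copy serving as the last element of the order.\<close>

lemma order_pair_no_separator:
  assumes D: "rooted V E r" and no: "\<And>c. \<not> separator V E r c"
  shows "\<exists>L M. order_pair V E r L M"
proof -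
  note V = rootedD[OF D]
  define W where "W = insert None (Some ` V)"
  define F where "F = map_prod Some Some ` E \<union> (\<lambda>v. (None, Some v)) ` (E `` {r})"
  have FI: "(Some u, Some v) \<in> F" if "(u, v) \<in> E" for u v using that unfolding F_def by force
  have FN: "(None, Some v) \<in> F" if "(r, v) \<in> E" for v using that unfolding F_def by force
  have FD: "\<exists>v. y = Some v \<and> (\<forall>u. x = Some u \<longrightarrow> (u, v) \<in> E) \<and> (x = None \<longrightarrow> (r, v) \<in> E)"
    if "(x, y) \<in> F" for x y using that unfolding F_def by auto
  have "st_connected W F (Some r) None"
  proof (rule st_connectedI)
    show "finite W" "Some r \<in> W" "None \<in> W" "Some r \<noteq> None" using V(1,2) unfolding W_def by auto
    show "F \<subseteq> W \<times> (W - {Some r, None})" using V(3) unfolding F_def W_def by auto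
    show "irrefl F" using V(4) unfolding F_def irrefl_def by auto
    fix A assume A: "A \<subseteq> W - {Some r, None}" "A \<noteq> {}"
    define B where "B = Some -` A"
    have AB: "A = Some ` B" using A unfolding B_def W_def by auto
    have BV: "B \<subseteq> V - {r}" "B \<noteq> {}" using A unfolding AB W_def by auto
    have fin: "finite (entry F A)"
      using V(6) by (intro finite_entry) (simp add: F_def finite_Image)
    have sub: "Some ` entry E B \<subseteq> entry F A"
    proof
      fix x assume "x \<in> Some ` entry E B"
      then obtain u v where "x = Some u" "u \<notin> B" "v \<in> B" "(u, v) \<in> E" unfolding entry_def by blast
      then show "x \<in> entry F A" using FI unfolding AB entry_def by blast
    qed
    obtain c where c: "c \<in> entry E B" using V(5)[OF BV] by blast
    \<comment> \<open>A set entered from \<open>r\<close> alone is possible here; the two copies of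
      the root then provide the two entry vertices.\<close>
    have "\<exists>x y. x \<noteq> y \<and> {x, y} \<subseteq> entry F A"
    proof (cases "c = r")
      case True
      then obtain v where "v \<in> B" "(r, v) \<in> E" using c unfolding entry_def by blast
      then have "None \<in> entry F A" using FN unfolding AB entry_def by blast
      moreover have "Some c \<in> entry F A" using c sub by blast
      ultimately have "None \<noteq> Some c" "{None, Some c} \<subseteq> entry F A" by auto
      then show ?thesis by (intro exI conjI)
    next
      case False
      then have "entry E B \<noteq> {c}" using no[of c] BV separatorI by metis
      then obtain d where "d \<in> entry E B" "d \<noteq> c" using c by blast
      then have "Some c \<noteq> Some d" "{Some c, Some d} \<subseteq> entry F A" using c sub by auto
      then show ?thesis by (intro exI conjI)
    qed
    then show "2 \<le> card (entry F A)" using fin by (metis card_2_iff card_mono)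
  qed
  then obtain L where L: "st_order W F (Some r) None L" by (rule exE[OF st_order_exists])
  then have T: "trans L" "irrefl L" unfolding st_order_def by blast+
  have asym: "(x, y) \<in> L \<Longrightarrow> (y, x) \<notin> L" for x y using T unfolding irrefl_def by (meson transD)
  define L1 where "L1 = {(x, y). (Some x, Some y) \<in> L}"
  \<comment> \<open>Reversing \<open>L\<close> would put the root last. It is moved to the front,
    where it takes over the role of the copy \<open>None\<close>.\<close>
  define M1 where "M1 = {(x, y). x = r \<and> y \<noteq> r \<or> x \<noteq> r \<and> y \<noteq> r \<and> (Some y, Some x) \<in> L}"
  have "order_pair V E r L1 M1"
  proof (rule order_pairI)
    show "trans L1" "irrefl L1" using T unfolding L1_def trans_def irrefl_def by blast+
    show "trans M1" "irrefl M1" using T unfolding M1_def trans_def irrefl_def by blast+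
    show "False" if "x \<in> V - {r}" "(x, y) \<in> L1" "(x, y) \<in> M1" for x y
      using that asym unfolding L1_def M1_def by blast
    fix v assume v: "v \<in> V - {r}"
    then have "Some v \<in> W - {Some r, None}" unfolding W_def by auto
    then obtain u w where uw: "(Some r, Some v) \<in> L" "(Some v, None) \<in> L"
      "(u, Some v) \<in> F" "(u, Some v) \<in> L" "(w, Some v) \<in> F" "(Some v, w) \<in> L"
      using L unfolding st_order_def by blast
    obtain u' where "u = Some u'" using uw(2,4) asym by (cases u) auto
    then have "(u', v) \<in> E \<and> (u', v) \<in> L1" using uw FD unfolding L1_def by blast
    moreover have "\<exists>w. (w, v) \<in> E \<and> (w, v) \<in> M1"
    proof (cases w)
      case None
      then show ?thesis using FD[OF uw(5)] v unfolding M1_def by auto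
    next
      case (Some x)
      then have "x \<noteq> r" using uw(1,6) asym by auto
      then show ?thesis using Some FD[OF uw(5)] uw(6) v unfolding M1_def by auto
    qed
    ultimately show "(\<exists>u. (u, v) \<in> E \<and> (u, v) \<in> L1) \<and> (\<exists>u. (u, v) \<in> E \<and> (u, v) \<in> M1)" by blast
  qed
  then show ?thesis by blast
qed

text \<open>The digraph with \<open>S\<close> contracted into \<open>c\<close> and the digraph on
  \<open>S\<close> with root \<open>c\<close> are ordered separately and combined by substitution.
  By maximality of \<open>S\<close>, \<open>c\<close> is not a separator of the contracted digraph.
  Hence the vertices of \<open>S\<close>, all placed where \<open>c\<close> is, do not precede a
  vertex outside in both orders.\<close>

lemma order_pair_separator:
  fixes V :: "'v set"
  assumes D: "rooted V E r" and c: "c \<noteq> r"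
    and S: "S \<subseteq> V - {r}" "S \<noteq> {}" "entry E S = {c}"
    and smax: "\<And>A. A \<subseteq> V - {r} \<Longrightarrow> entry E A = {c} \<Longrightarrow> A \<subseteq> S"
    and IH: "\<And>(V' :: 'v set) E' r'. card V' < card V \<Longrightarrow> rooted V' E' r' \<Longrightarrow> \<exists>L M. order_pair V' E' r' L M"
  shows "\<exists>L M. order_pair V E r L M"
proof -
  note V = rootedD[OF D]
  have cV: "c \<in> V" "c \<notin> S" using S(3) V(3) unfolding entry_def by blast+
  have into_S: "u = c \<or> u \<in> S" if "(u, v) \<in> E" "v \<in> S" for u v using that S(3) unfolding entry_def by blast
  define p where "p = (\<lambda>x. if x \<in> S then c else x)"
  define V1 where "V1 = V - S"
  define E1 where "E1 = quot p E"
  define V2 where "V2 = insert c S"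
  define E2 where "E2 = E \<inter> UNIV \<times> S"
  have fin: "finite V1" "finite V2" using V(1) S(1) unfolding V1_def V2_def by (auto intro: finite_subset)
  have smaller: "card V1 < card V" "card V2 < card V"
    using S c cV V(1,2) unfolding V1_def V2_def by (auto intro!: psubset_card_mono)
  have vim_in: "p -` A = A \<union> S" if "c \<in> A" for A using that unfolding p_def by (auto split: if_splits)
  have vim_out: "p -` A = A" if "c \<notin> A" "A \<subseteq> V1" for A
    using that unfolding p_def V1_def by (auto split: if_splits)
  have V1r: "A \<subseteq> V - {r}" if "A \<subseteq> V1 - {r}" for A using that unfolding V1_def by blast
  have entry1: "entry E1 A = p ` entry E A" if "c \<notin> A" "A \<subseteq> V1 - {r}" for A
    unfolding E1_def entry_quot using vim_out[OF that(1)] that(2) by (metis Diff_subset subset_trans)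
  have entry1_c: "entry E1 A = entry E (A \<union> S)" if "c \<in> A" for A
  proof -
    have "p ` entry E (A \<union> S) = entry E (A \<union> S)" unfolding p_def entry_def by force
    then show ?thesis unfolding E1_def entry_quot vim_in[OF that] .
  qed
  have rooted1: "rooted V1 E1 r"
  proof (rule rootedI)
    show "finite V1" "r \<in> V1" using fin V(2) S(1) unfolding V1_def by auto
    show "E1 \<subseteq> V1 \<times> (V1 - {r})" using V(3) cV c unfolding E1_def quot_def p_def V1_def by auto
    show "irrefl E1" unfolding E1_def quot_def irrefl_def by auto
    fix A assume A: "A \<subseteq> V1 - {r}" "A \<noteq> {}"
    show "entry E1 A \<noteq> {}"
    proof (cases "c \<in> A")
      case True
      then show ?thesis using entry1_c V(5)[of "A \<union> S"] V1r[OF A(1)] A(2) S(1) by auto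
    next
      case False
      then show ?thesis using entry1 V(5)[of A] V1r[OF A(1)] A by auto
    qed
  qed
  have sep1: "separator V E r x" if "separator V1 E1 r x" "x \<in> V1" "x \<noteq> c" for x
  proof -
    obtain A where A: "x \<noteq> r" "A \<subseteq> V1 - {r}" "A \<noteq> {}" "entry E1 A = {x}"
      using \<open>separator V1 E1 r x\<close> unfolding separator_def by blast
    show ?thesis
    proof (cases "c \<in> A")
      case True
      have "A \<union> S \<subseteq> V - {r}" using V1r[OF A(2)] S(1) by blast
      moreover have "A \<union> S \<noteq> {}" using A(3) by blast
      ultimately show ?thesis using A(1,4) entry1_c[OF True] separatorI by metis
    next
      case False
      then have px: "p ` entry E A = {x}" using entry1 A by metis
      have "y = x" if "y \<in> entry E A" for y
      proof -
        have "p y = x" using that px by blast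
        then show ?thesis using \<open>x \<noteq> c\<close> unfolding p_def by (auto split: if_splits)
      qed
      moreover have "entry E A \<noteq> {}" using px by blast
      ultimately have "entry E A = {x}" by blast
      then show ?thesis using A(1,3) V1r[OF A(2)] separatorI by metis
    qed
  qed
  have nsep_c: "\<not> separator V1 E1 r c"
  proof
    assume "separator V1 E1 r c"
    then obtain A where A: "A \<subseteq> V1 - {r}" "A \<noteq> {}" "entry E1 A = {c}"
      unfolding separator_def by blast
    have nA: "c \<notin> A" using A(3) unfolding entry_def by blast
    have "p ` entry E A = {c}" using entry1[OF nA A(1)] A(3) by metis
    then have "p y = c" if "y \<in> entry E A" for y using that by blast
    then have "entry E A \<subseteq> insert c S" unfolding p_def by (metis insertI1 insertI2 subsetI)
    then have sub: "entry E (A \<union> S) \<subseteq> {c}" using S(3) unfolding entry_def by blast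
    have AS: "A \<union> S \<subseteq> V - {r}" using V1r[OF A(1)] S(1) by blast
    then have "entry E (A \<union> S) = {c}" using sub V(5)[of "A \<union> S"] A(2) by blast
    then have "A \<subseteq> S" using smax[OF AS] by blast
    then show False using A(1,2) unfolding V1_def by blast
  qed
  have entry2: "entry E2 A = entry E A" if "A \<subseteq> S" for A using that unfolding entry_def E2_def by blast
  have rooted2: "rooted V2 E2 c"
  proof (rule rootedI)
    show "finite V2" "c \<in> V2" using fin unfolding V2_def by auto
    show "E2 \<subseteq> V2 \<times> (V2 - {c})" using into_S cV(2) unfolding E2_def V2_def by auto
    show "irrefl E2" using V(4) unfolding E2_def irrefl_def by blast
    fix A assume A: "A \<subseteq> V2 - {c}" "A \<noteq> {}"
    then have "A \<subseteq> S" unfolding V2_def by blast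
    then show "entry E2 A \<noteq> {}" using entry2 V(5)[of A] A(2) S(1) by blast
  qed
  have sep2: "separator V E r x" if "separator V2 E2 c x" "x \<in> S" for x
  proof -
    obtain A where A: "A \<subseteq> V2 - {c}" "A \<noteq> {}" "entry E2 A = {x}"
      using \<open>separator V2 E2 c x\<close> unfolding separator_def by blast
    then have "A \<subseteq> S" unfolding V2_def by blast
    then have "A \<subseteq> V - {r}" "entry E A = {x}" using S(1) entry2 A(3) by blast+
    then show ?thesis using A(2) \<open>x \<in> S\<close> S(1) separatorI[of x r A] by blast
  qed
  obtain L1 M1 where 1: "order_pair V1 E1 r L1 M1" using IH[OF smaller(1) rooted1] by blast
  obtain L2 M2 where 2: "order_pair V2 E2 c L2 M2" using IH[OF smaller(2) rooted2] by blast
  have T: "trans L1" "irrefl L1" "trans M1" "irrefl M1" "trans L2" "irrefl L2" "trans M2" "irrefl M2"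
    using 1 2 unfolding order_pair_def by blast+
  have pS: "p x = c" if "x \<in> S" for x using that unfolding p_def by simp
  have pc: "p c = c" unfolding p_def by simp
  have pnS: "p x = x" if "x \<notin> S" for x using that unfolding p_def by simp
  have pV1: "p x \<in> V1" if "x \<in> V" for x using that cV unfolding p_def V1_def by auto
  let ?L = "lex_over p L1 L2" and ?M = "lex_over p M1 M2"
  have "order_pair V E r ?L ?M"
  proof (rule order_pairI)
    show "trans ?L" "irrefl ?L" "trans ?M" "irrefl ?M" using T trans_lex_over irrefl_lex_over by blast+
    fix v assume v: "v \<in> V - {r}"
    show "(\<exists>u. (u, v) \<in> E \<and> (u, v) \<in> ?L) \<and> (\<exists>u. (u, v) \<in> E \<and> (u, v) \<in> ?M)"
    proof (cases "v \<in> S")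
      case True
      then have "v \<in> V2 - {c}" using cV unfolding V2_def by blast
      then obtain u u' where u: "(u, v) \<in> E2" "(u, v) \<in> L2" "(u', v) \<in> E2" "(u', v) \<in> M2"
        using 2 unfolding order_pair_def by blast
      then have "p u = c" "p u' = c" using into_S True pS pc unfolding E2_def by blast+
      then show ?thesis using u pS[OF True] unfolding lex_over_def E2_def by auto
    next
      case False
      then have "v \<in> V1 - {r}" using v unfolding V1_def by blast
      then obtain u u' where u: "(u, v) \<in> E1" "(u, v) \<in> L1" "(u', v) \<in> E1" "(u', v) \<in> M1"
        using 1 unfolding order_pair_def by blast
      have lift: "\<exists>x. (x, v) \<in> E \<and> p x = u" if uv: "(u, v) \<in> E1" for u
      proof -
        obtain x y where xy: "(x, y) \<in> E" "p x = u" "p y = v" "u \<noteq> v" using uv unfolding E1_def quot_def by blast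
        have "y \<notin> S"
        proof
          assume "y \<in> S"
          then have "p x = c" "p y = c" using into_S[OF xy(1)] pS pc by blast+
          then show False using xy by simp
        qed
        then show ?thesis using xy pnS by metis
      qed
      show ?thesis using lift[OF u(1)] lift[OF u(3)] u(2,4) pnS[OF False] unfolding lex_over_def by auto
    qed
  next
    fix x y assume x: "x \<in> V - {r}" "\<not> separator V E r x" "y \<in> V" "(x, y) \<in> ?L" "(x, y) \<in> ?M"
    have irr: "(a, a) \<notin> L1" "(a, a) \<notin> M1" for a using T unfolding irrefl_def by blast+
    show False
    proof (cases "p x = p y")
      case True
      then have LM: "(x, y) \<in> L2" "(x, y) \<in> M2" using x(4,5) irr unfolding lex_over_def by auto
      then have "x \<noteq> y" using T unfolding irrefl_def by blast
      moreover have "x \<noteq> c" using x(2) S c separatorI by metis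
      ultimately have "x \<in> S" "y \<in> V2" using True pS pnS unfolding V2_def by (metis insertCI)+
      then show False using 2 LM sep2[OF _ \<open>x \<in> S\<close>] x(2) cV unfolding order_pair_def V2_def by blast
    next
      case False
      then have LM: "(p x, p y) \<in> L1" "(p x, p y) \<in> M1" using x(4,5) unfolding lex_over_def by auto
      have px: "p x \<in> V1 - {r}" using x(1) pV1 pS pnS c by (metis DiffD1 DiffD2 DiffI singletonD singletonI)
      have "\<not> separator V1 E1 r (p x)"
      proof (cases "p x = c")
        case True then show ?thesis using nsep_c by simp
      next
        case False
        then have "p x = x" using pS pnS by blast
        then show ?thesis using sep1[of x] x(2) px False by auto
      qed
      then show False using 1 LM px pV1[OF x(3)] unfolding order_pair_def by blast
    qed
  qed
  then show ?thesis by blast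
qed

theorem order_pair_exists: "rooted V E r \<Longrightarrow> \<exists>L M. order_pair V E r L M"
proof (induction "card V" arbitrary: V E r rule: less_induct)
  case less
  show ?case
  proof (cases "\<exists>c. separator V E r c")
    case False
    then show ?thesis using order_pair_no_separator[OF less.prems] by blast
  next
    case True
    then obtain c where c: "c \<noteq> r" "\<exists>A \<subseteq> V - {r}. A \<noteq> {} \<and> entry E A = {c}" unfolding separator_def by blast
    note V = rootedD[OF less.prems]
    define \<S> where "\<S> = {A. A \<subseteq> V - {r} \<and> entry E A = {c}}"
    have S: "\<Union>\<S> \<subseteq> V - {r}" "\<Union>\<S> \<noteq> {}" using c(2) unfolding \<S>_def by blast+
    have "entry E (\<Union>\<S>) \<subseteq> {c}" unfolding entry_def \<S>_def by blast
    then have "entry E (\<Union>\<S>) = {c}" using V(5)[OF S] by blast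
    then show ?thesis
      by (rule order_pair_separator[OF less.prems c(1) S]) (use less.hyps in \<open>auto simp: \<S>_def\<close>)
  qed
qed

section \<open>Leaves of branchings\<close>

definition par :: "'v set \<Rightarrow> 'v \<Rightarrow> ('v \<Rightarrow> 'v) \<Rightarrow> ('v \<times> 'v) set" where
  "par V r f = {(f v, v) | v. v \<in> V - {r}}"

text \<open>Outbranchings are represented by parent functions. Acyclicity stands in for
  connectedness: in a finite rooted digraph, following parents without a cycle can only stop at the
  root.\<close>

definition branching :: "'v set \<Rightarrow> ('v \<times> 'v) set \<Rightarrow> 'v \<Rightarrow> ('v \<Rightarrow> 'v) \<Rightarrow> bool" where
  "branching V E r f \<longleftrightarrow> par V r f \<subseteq> E \<and> acyclic (par V r f)"

definition leaf_bound :: "'v set \<Rightarrow> ('v \<times> 'v) set \<Rightarrow> 'v \<Rightarrow> nat \<Rightarrow> bool" where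
  "leaf_bound V E r l \<longleftrightarrow> (\<forall>f. branching V E r f \<longrightarrow> card (V - f ` (V - {r})) \<le> l)"

definition siblings :: "'v set \<Rightarrow> 'v \<Rightarrow> ('v \<Rightarrow> 'v) \<Rightarrow> 'v set" where
  "siblings V r f = {v \<in> V - {r}. \<exists>w \<in> V - {r}. w \<noteq> v \<and> f w = f v}"

text \<open>These are the vertices whose parent can be replaced in the given branching: making
  \<open>x\<close> the parent of \<open>v\<close> closes a cycle only if \<open>x\<close> is a
  descendant of \<open>v\<close>.\<close>

definition side_entered :: "'v set \<Rightarrow> ('v \<times> 'v) set \<Rightarrow> 'v \<Rightarrow> ('v \<Rightarrow> 'v) \<Rightarrow> 'v set" where
  "side_entered V E r f = {v \<in> V - {r}. \<exists>x. (x, v) \<in> E \<and> x \<noteq> f v \<and> (v, x) \<notin> (par V r f)\<^sup>*}"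

lemma par_iff: "(u, v) \<in> par V r f \<longleftrightarrow> v \<in> V - {r} \<and> u = f v"
  unfolding par_def by blast

lemma acyclic_if_subset_order: "R \<subseteq> P \<Longrightarrow> trans P \<Longrightarrow> irrefl P \<Longrightarrow> acyclic R"
  by (metis acyclic_irrefl acyclic_subset trancl_id)

lemma branchingI:
  assumes "\<And>v. v \<in> V - {r} \<Longrightarrow> (f v, v) \<in> E \<and> (f v, v) \<in> P" "trans P" "irrefl P"
  shows "branching V E r f"
proof -
  have "par V r f \<subseteq> P" "par V r f \<subseteq> E" using assms(1) unfolding par_def by blast+
  then show ?thesis using acyclic_if_subset_order assms(2,3) unfolding branching_def by blast
qed

text \<open>For a multigraph with n vertices and m edges this is the bound (2n - m)/3, attained by a
  single edge and by a triangle. Deleting a vertex of degree at least 3 costs nothing in it. If all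
  degrees are at most 2, a vertex of minimum degree is selected and its closed neighbourhood
  \<open>C\<close> deleted.\<close>

lemma independent_set:
  fixes f g :: "'e \<Rightarrow> 'v"
  assumes "finite W" "finite Z" "\<And>z. z \<in> Z \<Longrightarrow> f z \<noteq> g z"
  shows "\<exists>I \<subseteq> W. (\<forall>z \<in> Z. \<not> (f z \<in> I \<and> g z \<in> I)) \<and> 2 * card W \<le> 3 * card I + card Z"
  using assms
proof (induction "card W" arbitrary: W Z rule: less_induct)
  case less
  define inc where "inc = (\<lambda>C. {z \<in> Z. f z \<in> C \<or> g z \<in> C})"
  have fin_inc: "finite (inc C)" and inc_sub: "inc C \<subseteq> Z" for C using less.prems(2) unfolding inc_def by auto
  have step: "\<exists>I \<subseteq> W - C. (\<forall>z \<in> Z - inc C. \<not> (f z \<in> I \<and> g z \<in> I)) \<and>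
    2 * card W + card (inc C) \<le> 3 * card I + card Z + 2 * card C" if C: "C \<subseteq> W" "C \<noteq> {}" for C
  proof -
    have fC: "finite C" using C(1) less.prems(1) finite_subset by blast
    have "card (W - C) < card W" using C less.prems(1) by (intro psubset_card_mono) auto
    then have "\<exists>I \<subseteq> W - C. (\<forall>z \<in> Z - inc C. \<not> (f z \<in> I \<and> g z \<in> I)) \<and> 2 * card (W - C) \<le> 3 * card I + card (Z - inc C)"
      using less.prems by (intro less.hyps) auto
    then obtain I where I: "I \<subseteq> W - C" "\<forall>z \<in> Z - inc C. \<not> (f z \<in> I \<and> g z \<in> I)"
      "2 * card (W - C) \<le> 3 * card I + card (Z - inc C)" by blast
    have "card (W - C) + card C = card W" "card (Z - inc C) + card (inc C) = card Z"
      using C(1) less.prems(1,2) fC fin_inc inc_sub card_mono[OF less.prems(1) C(1)] card_mono[OF less.prems(2) inc_sub]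
      by (simp_all add: card_Diff_subset)
    then show ?thesis using I by (intro exI[of _ I]) linarith
  qed
  consider "W = {}" | w where "w \<in> W" "3 \<le> card (inc {w})"
    | "W \<noteq> {}" "\<And>w. w \<in> W \<Longrightarrow> card (inc {w}) \<le> 2" by fastforce
  then show ?case
  proof cases
    case 1 then show ?thesis by simp
  next
    case (2 w)
    then obtain I where I: "I \<subseteq> W - {w}" "\<forall>z \<in> Z - inc {w}. \<not> (f z \<in> I \<and> g z \<in> I)"
      "2 * card W + card (inc {w}) \<le> 3 * card I + card Z + 2 * card {w}" using step[of "{w}"] by auto
    have "\<forall>z \<in> Z. \<not> (f z \<in> I \<and> g z \<in> I)" using I(1,2) unfolding inc_def by blast
    moreover have "2 * card W \<le> 3 * card I + card Z" using I(3) 2(2) by simp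
    ultimately show ?thesis using I(1) by blast
  next
    case 3
    obtain w where w: "w \<in> W" "\<And>x. x \<in> W \<Longrightarrow> card (inc {w}) \<le> card (inc {x})"
      using 3(1) ex_has_least_nat[of "\<lambda>x. x \<in> W" _ "\<lambda>x. card (inc {x})"] by blast
    define C where "C = W \<inter> insert w (f ` inc {w} \<union> g ` inc {w})"
    have wC: "w \<in> C" "C \<subseteq> W" using w unfolding C_def by auto
    have Cends: "C \<subseteq> insert w ((\<lambda>z. if f z = w then g z else f z) ` inc {w})"
      unfolding C_def inc_def by auto
    have cC: "card C \<le> 1 + card (inc {w})"
    proof -
      have "card C \<le> card (insert w ((\<lambda>z. if f z = w then g z else f z) ` inc {w}))"
        by (rule card_mono[OF _ Cends]) (simp add: fin_inc)
      also have "\<dots> \<le> Suc (card ((\<lambda>z. if f z = w then g z else f z) ` inc {w}))" by (simp add: fin_inc card_insert_if)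
      also have "\<dots> \<le> Suc (card (inc {w}))" using card_image_le[OF fin_inc] by (simp only: Suc_le_mono)
      finally show ?thesis by simp
    qed
    have inc_mono: "inc {x} \<subseteq> inc C" if "x \<in> C" for x using that unfolding inc_def by auto
    have cw: "card (inc {w}) \<le> card (inc C)" by (rule card_mono[OF fin_inc inc_mono[OF wC(1)]])
    \<comment> \<open>If \<open>w\<close> has degree d, then \<open>C\<close> has at most d + 1
      vertices, which suffices for d \<le> 1. For d = 2 a third edge at \<open>C\<close> suffices;
      without one, minimality of the degree makes all of \<open>C\<close> incident with the same
      edges, so \<open>C\<close> has at most two vertices.\<close>
    have "2 * card C \<le> 3 + card (inc C)"
    proof (cases "card (inc {w}) = 2 \<and> card (inc C) \<le> 2")
      case False
      then show ?thesis using cC cw 3(2)[OF w(1)] by linarith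
    next
      case True
      then obtain z where z: "z \<in> inc {w}" by fastforce
      have "inc {x} = inc C" if "x \<in> C" for x
        using w(2)[of x] that wC True by (intro card_seteq[OF fin_inc inc_mono]) auto
      moreover have "z \<in> inc C" using z inc_mono[OF wC(1)] by blast
      ultimately have "z \<in> inc {x}" if "x \<in> C" for x using that by blast
      then have "C \<subseteq> {f z, g z}" unfolding inc_def by auto
      then have "card C \<le> card {f z, g z}" by (intro card_mono) auto
      also have "\<dots> \<le> 2" by (simp add: card_insert_if)
      finally show ?thesis using True cw by linarith
    qed
    moreover obtain I where I: "I \<subseteq> W - C" "\<forall>z \<in> Z - inc C. \<not> (f z \<in> I \<and> g z \<in> I)"
      "2 * card W + card (inc C) \<le> 3 * card I + card Z + 2 * card C" using step[of C] wC by auto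
    moreover have "card (insert w I) = Suc (card I)"
      using I(1) wC less.prems(1) by (intro card_insert_disjoint) (auto intro: finite_subset)
    ultimately have "2 * card W \<le> 3 * card (insert w I) + card Z" by linarith
    moreover have "insert w I \<subseteq> W" using I(1) wC by blast
    moreover have "\<forall>z \<in> Z. \<not> (f z \<in> insert w I \<and> g z \<in> insert w I)"
    proof (intro ballI notI)
      fix z assume z: "z \<in> Z" "f z \<in> insert w I \<and> g z \<in> insert w I"
      have IW: "x \<in> W" "x \<notin> C" if "x \<in> I" for x using that I(1) by blast+
      show False
      proof (cases "z \<in> inc {w}")
        case True
        then have "f z \<in> insert w C" "g z \<in> insert w C" using z IW wC unfolding C_def by auto
        then have "f z = w" "g z = w" using z IW wC by auto
        then show False using less.prems(3)[OF z(1)] by simp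
      next
        case False
        then have "f z \<in> I" "g z \<in> I" using z unfolding inc_def by auto
        moreover have "z \<notin> inc C" using IW calculation unfolding inc_def by blast
        ultimately show False using I(2) z(1) by blast
      qed
    qed
    ultimately show ?thesis by blast
  qed
qed

text \<open>A vertex \<open>z\<close> in \<open>Z\<close> may use either parent, so it acts as an
  edge between \<open>f z\<close> and \<open>g z\<close>. An independent set that avoids the forced
  parents \<open>F\<close> can be turned into leaves. Outside \<open>F\<close> there are at least
  |Z| + 1 vertices, and with |Z| edges the independent set has at least (|Z| + 2)/3
  elements.\<close>

lemma two_parents:
  assumes V: "finite V" "r \<in> V" and l: "leaf_bound V E r l" and P: "trans P" "irrefl P"
    and f: "\<And>v. v \<in> V - {r} \<Longrightarrow> (f v, v) \<in> E \<and> (f v, v) \<in> P"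
    and g: "\<And>v. v \<in> V - {r} \<Longrightarrow> (g v, v) \<in> E \<and> (g v, v) \<in> P"
  shows "card {v \<in> V - {r}. f v \<noteq> g v} + 2 \<le> 3 * l"
proof -
  define Z where "Z = {v \<in> V - {r}. f v \<noteq> g v}"
  define F where "F = f ` (V - {r} - Z)"
  have Z: "finite Z" "Z \<subseteq> V - {r}" using V unfolding Z_def by auto
  have "\<exists>I \<subseteq> V - F. (\<forall>z \<in> Z. \<not> (f z \<in> I \<and> g z \<in> I)) \<and> 2 * card (V - F) \<le> 3 * card I + card Z"
    by (rule independent_set) (use V Z in \<open>auto simp: Z_def\<close>)
  then obtain I where I: "I \<subseteq> V - F" "\<And>z. z \<in> Z \<Longrightarrow> \<not> (f z \<in> I \<and> g z \<in> I)"
    "2 * card (V - F) \<le> 3 * card I + card Z" by blast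
  have "card F \<le> card (V - {r} - Z)" unfolding F_def using V by (intro card_image_le) auto
  moreover have "card (V - {r} - Z) + card Z + 1 = card V"
    using V Z card_mono[OF _ Z(2)] card_gt_0_iff[of V] by (auto simp: card_Diff_subset)
  moreover have "card V - card F \<le> card (V - F)" using V by (intro diff_card_le_card_Diff) (simp add: F_def)
  ultimately have big: "card Z + 1 \<le> card (V - F)" by linarith
  define h where "h = (\<lambda>v. if v \<in> Z \<and> f v \<in> I then g v else f v)"
  have "branching V E r h" by (rule branchingI[OF _ P]) (use f g in \<open>auto simp: h_def\<close>)
  then have "card (V - h ` (V - {r})) \<le> l" using l unfolding leaf_bound_def by blast
  moreover have "h v \<notin> I" if v: "v \<in> V - {r}" for v
  proof (cases "v \<in> Z")
    case True then show ?thesis using I(2) unfolding h_def by auto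
  next
    case False
    then have "f v \<in> F" using v unfolding F_def by blast
    then show ?thesis using False I(1) unfolding h_def by auto
  qed
  then have "I \<subseteq> V - h ` (V - {r})" using I(1) by blast
  then have "card I \<le> card (V - h ` (V - {r}))" using V by (intro card_mono) auto
  ultimately show ?thesis using I(3) big unfolding Z_def by linarith
qed

text \<open>An element alone in its fibre contributes one value; the others contribute at most one
  value per two elements.\<close>

lemma card_nonunique_image:
  assumes "finite A"
  shows "card {x \<in> A. \<exists>y \<in> A. y \<noteq> x \<and> f y = f x} + 2 * card (f ` A) \<le> 2 * card A"
proof -
  define M where "M = {x \<in> A. \<exists>y \<in> A. y \<noteq> x \<and> f y = f x}"
  have M: "M \<subseteq> A" "finite M" using assms unfolding M_def by auto
  have "2 \<le> card {x \<in> M. f x = y}" if y: "y \<in> f ` M" for y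
  proof -
    obtain a b where "a \<in> M" "f a = y" "b \<in> A" "b \<noteq> a" "f b = f a" using y unfolding M_def by blast
    then have "{a, b} \<subseteq> {x \<in> M. f x = y}" "card {a, b} = 2" unfolding M_def by auto
    then show ?thesis using M(2) card_mono[of "{x \<in> M. f x = y}" "{a, b}"] by simp
  qed
  then have "card (f ` M) * 2 \<le> (\<Sum>y \<in> f ` M. card {x \<in> M. f x = y})"
    using sum_bounded_below[of "f ` M" 2 "\<lambda>y. card {x \<in> M. f x = y}"] by simp
  also have "\<dots> = card M" using sum.image_gen[OF M(2), of "\<lambda>_. 1 :: nat" f] by simp
  finally have 1: "2 * card (f ` M) \<le> card M" by simp
  have "f ` A = f ` M \<union> f ` (A - M)" using M by blast
  then have "card (f ` A) \<le> card (f ` M) + card (f ` (A - M))" by (simp add: card_Un_le)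
  also have "card (f ` (A - M)) \<le> card (A - M)" using assms by (intro card_image_le) auto
  also have "card (A - M) = card A - card M" using M by (simp add: card_Diff_subset)
  finally show ?thesis using 1 card_mono[OF assms M(1)] unfolding M_def[symmetric] by linarith
qed

text \<open>All but at most \<open>l\<close> vertices are parents, so on the |V| - 1 vertices other
  than the root \<open>f\<close> loses at most \<open>l\<close> - 1 values, each accounting for at
  most two siblings.\<close>

lemma card_siblings:
  assumes V: "finite V" "r \<in> V" and l: "leaf_bound V E r l" and f: "branching V E r f"
  shows "card (siblings V r f) + 2 \<le> 2 * l"
proof -
  have "card V - card (f ` (V - {r})) \<le> card (V - f ` (V - {r}))"
    using V by (intro diff_card_le_card_Diff) auto
  also have "\<dots> \<le> l" using l f unfolding leaf_bound_def by blast
  finally have "card V \<le> card (f ` (V - {r})) + l" by simp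
  moreover have "card (siblings V r f) + 2 * card (f ` (V - {r})) \<le> 2 * card (V - {r})"
    unfolding siblings_def using V by (intro card_nonunique_image) auto
  moreover have "card (V - {r}) + 1 = card V" using V by (metis Suc_eq_plus1 card_Suc_Diff1)
  ultimately show ?thesis by linarith
qed

lemma wf_par: "finite V \<Longrightarrow> branching V E r f \<Longrightarrow> wf (par V r f)"
  unfolding branching_def by (intro finite_acyclic_wf) (auto simp: par_def)

text \<open>Vertices are labelled by their paths from the root, so that ancestors correspond to
  prefixes and preorder traversals to lexicographic orders.\<close>

lemma root_paths:
  assumes "finite V" "branching V E r f"
  obtains path where
    "\<And>x. x \<in> V - {r} \<Longrightarrow> path x = path (f x) @ [x]" "\<And>x. x \<notin> V - {r} \<Longrightarrow> path x = [x]"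
proof
  let ?F = "\<lambda>pa x. if x \<in> V - {r} then pa (f x) @ [x] else [x]"
  let ?path = "wfrec (par V r f) ?F"
  have rec: "?path x = ?F (cut ?path (par V r f) x) x" for x using wfrec[OF wf_par[OF assms]] .
  show "?path x = ?path (f x) @ [x]" if "x \<in> V - {r}" for x
    using rec[of x] that cut_apply[of "f x" x "par V r f" ?path] by (simp add: par_iff)
  show "?path x = [x]" if "x \<notin> V - {r}" for x using rec[of x] that by auto
qed

text \<open>The two orders are preorder traversals of the branching, with opposite orders of siblings.\<close>

lemma two_preorders:
  fixes V :: "'v set"
  assumes V: "finite V" and f: "branching V E r f"
  obtains P Q where "trans P" "irrefl P" "trans Q" "irrefl Q" "par V r f \<subseteq> P" "par V r f \<subseteq> Q"
    "\<And>x v. x \<noteq> v \<Longrightarrow> (v, x) \<notin> (par V r f)\<^sup>* \<Longrightarrow> (x, v) \<in> P \<or> (x, v) \<in> Q"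
proof -
  obtain path where path: "\<And>x. x \<in> V - {r} \<Longrightarrow> path x = path (f x) @ [x]" "\<And>x. x \<notin> V - {r} \<Longrightarrow> path x = [x]"
    using root_paths[OF V f] by blast
  have last: "last (path x) = x" "path x \<noteq> []" for x using path by (cases "x \<in> V - {r}"; simp)+
  have anc: "(v, x) \<in> (par V r f)\<^sup>*" if "prefix (path v) (path x)" for v x
    using wf_par[OF V f] that
  proof (induction x rule: wf_induct_rule)
    case (less x)
    show ?case
    proof (cases "path v = path x")
      case True then show ?thesis using last by (metis rtrancl.rtrancl_refl)
    next
      case ne: False
      show ?thesis
      proof (cases "x \<in> V - {r}")
        case True
        then have "(f x, x) \<in> par V r f" by (simp add: par_iff)
        moreover have "prefix (path v) (path (f x))" using less.prems ne path(1)[OF True] by (simp add: prefix_snoc)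
        ultimately show ?thesis using less.IH by (meson rtrancl.rtrancl_into_rtrancl)
      next
        case False
        then show ?thesis using less.prems ne last(2)[of v] path(2)[OF False] by (simp add: prefix_Cons)
      qed
    qed
  qed
  \<comment> \<open>A well-order supplies a strict total order by which siblings are compared; its
    converse gives the opposite traversal.\<close>
  obtain W :: "('v \<times> 'v) set" where W: "well_order_on UNIV W" using well_order_on[of UNIV] by blast
  define R where "R = W - Id"
  have R: "trans R" "irrefl R" "\<And>a b. a \<noteq> b \<Longrightarrow> (a, b) \<in> R \<or> (a, b) \<in> R\<inverse>"
    using W unfolding R_def well_order_on_def linear_order_on_def partial_order_on_def preorder_on_def total_on_def
    by (auto simp: trans_diff_Id irrefl_def)
  have Rc: "trans (R\<inverse>)" "irrefl (R\<inverse>)" using R by (auto simp: irrefl_def)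
  define ord where "ord = (\<lambda>R. {(x, y). (path x, path y) \<in> lexord R})"
  have tr: "trans (ord R)" if "trans R" for R
    unfolding ord_def trans_def using lexord_trans that by blast
  have irr: "irrefl (ord R)" if "irrefl R" for R
    unfolding ord_def irrefl_def using lexord_irreflexive that unfolding irrefl_def by blast
  have sub: "par V r f \<subseteq> ord R" for R
    unfolding ord_def using path(1) by (auto simp: par_def lexord_append_rightI)
  \<comment> \<open>If the path to \<open>x\<close> is a prefix of the path to \<open>v\<close>,
    both traversals visit \<open>x\<close> first. Otherwise the paths diverge, since
    \<open>x\<close> is not below \<open>v\<close>, and the two traversals compare the vertices
    after the divergence in opposite ways.\<close>
  have "(x, v) \<in> ord R \<or> (x, v) \<in> ord (R\<inverse>)" if xv: "x \<noteq> v" "(v, x) \<notin> (par V r f)\<^sup>*" for x v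
  proof (cases "prefix (path x) (path v)")
    case True
    then obtain zs where zs: "path v = path x @ zs" unfolding prefix_def by blast
    then have "zs \<noteq> []" using last xv(1) by (metis append_Nil2)
    then show ?thesis using zs unfolding ord_def by (auto simp: neq_Nil_conv lexord_append_rightI)
  next
    case False
    then have "path x \<parallel> path v" using anc xv(2) by blast
    then obtain as b bs c cs where bc: "b \<noteq> c" "path x = as @ b # bs" "path v = as @ c # cs"
      using parallel_decomp by blast
    have "(path x, path v) \<in> lexord R'" if "(b, c) \<in> R'" for R'
      using that bc(2,3) unfolding lexord_def by blast
    then show ?thesis using R(3)[OF bc(1)] unfolding ord_def by blast
  qed
  with tr irr R Rc sub show thesis by (intro that[of "ord R" "ord (R\<inverse>)"]) auto
qed

text \<open>Each alternative parent counted precedes its vertex in one of two orders, both of which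
  contain the branching itself. For either order \<open>two_parents\<close> bounds the vertices
  concerned by 3l - 2.\<close>

lemma card_side_entered:
  assumes V: "finite V" "r \<in> V" and l: "leaf_bound V E r l" and f: "branching V E r f" and E: "irrefl E"
  shows "card (side_entered V E r f) + 4 \<le> 6 * l"
proof -
  obtain P Q where PQ: "trans P" "irrefl P" "trans Q" "irrefl Q" "par V r f \<subseteq> P" "par V r f \<subseteq> Q"
    "\<And>x v. x \<noteq> v \<Longrightarrow> (v, x) \<notin> (par V r f)\<^sup>* \<Longrightarrow> (x, v) \<in> P \<or> (x, v) \<in> Q"
    using two_preorders[OF V(1) f] by metis
  have fE: "(f v, v) \<in> E" if "v \<in> V - {r}" for v using that f unfolding branching_def par_def by blast
  define A where "A = (\<lambda>P. {v \<in> V - {r}. \<exists>x. (x, v) \<in> E \<and> x \<noteq> f v \<and> (x, v) \<in> P})"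
  have bound: "card (A P) + 2 \<le> 3 * l" if P: "trans P" "irrefl P" "par V r f \<subseteq> P" for P
  proof -
    define g where "g = (\<lambda>v. if v \<in> A P then SOME x. (x, v) \<in> E \<and> x \<noteq> f v \<and> (x, v) \<in> P else f v)"
    have gA: "(g v, v) \<in> E \<and> g v \<noteq> f v \<and> (g v, v) \<in> P" if v: "v \<in> A P" for v
    proof -
      have "\<exists>x. (x, v) \<in> E \<and> x \<noteq> f v \<and> (x, v) \<in> P" using v unfolding A_def by blast
      from someI_ex[OF this] show ?thesis using v unfolding g_def by simp
    qed
    have fP: "(f v, v) \<in> P" if "v \<in> V - {r}" for v using that P(3) unfolding par_def by blast
    have "A P = {v \<in> V - {r}. f v \<noteq> g v}"
    proof -
      have "A P \<subseteq> V - {r}" unfolding A_def by blast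
      moreover have "f v = g v" if "v \<notin> A P" for v using that unfolding g_def by simp
      ultimately show ?thesis using gA by (intro equalityI subsetI CollectI conjI) (force+)
    qed
    moreover have "card {v \<in> V - {r}. f v \<noteq> g v} + 2 \<le> 3 * l"
    proof (rule two_parents[OF V l P(1,2)])
      show "(f v, v) \<in> E \<and> (f v, v) \<in> P" if "v \<in> V - {r}" for v using fE fP that by blast
      show "(g v, v) \<in> E \<and> (g v, v) \<in> P" if "v \<in> V - {r}" for v
        using fE[OF that] fP[OF that] gA[of v] unfolding g_def by (cases "v \<in> A P") auto
    qed
    ultimately show ?thesis by simp
  qed
  have "side_entered V E r f \<subseteq> A P \<union> A Q"
  proof
    fix v assume "v \<in> side_entered V E r f"
    then obtain x where x: "v \<in> V - {r}" "(x, v) \<in> E" "x \<noteq> f v" "(v, x) \<notin> (par V r f)\<^sup>*"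
      unfolding side_entered_def by blast
    then have "x \<noteq> v" using E unfolding irrefl_def by metis
    then show "v \<in> A P \<union> A Q" using PQ(7)[OF _ x(4)] x(1-3) unfolding A_def by blast
  qed
  then have "card (side_entered V E r f) \<le> card (A P \<union> A Q)"
    using V(1) by (intro card_mono) (auto simp: A_def)
  also have "\<dots> \<le> card (A P) + card (A Q)" by (rule card_Un_le)
  finally show ?thesis using bound[OF PQ(1,2,5)] bound[OF PQ(3,4,6)] by linarith
qed

section \<open>Counting special vertices\<close>

lemma par_rtrancl_order:
  assumes "\<And>v. v \<in> V - {r} \<Longrightarrow> (f v, v) \<in> P" "trans P" "(x, y) \<in> (par V r f)\<^sup>*" "x \<noteq> y"
  shows "(x, y) \<in> P"
proof -
  have "par V r f \<subseteq> P" using assms(1) unfolding par_def by blast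
  moreover have "(x, y) \<in> (par V r f)\<^sup>+" using assms(3,4) by (meson rtranclD)
  ultimately show ?thesis using assms(2) trancl_mono trancl_id by metis
qed

lemma not_siblingD: "v \<in> V - {r} \<Longrightarrow> w \<in> V - {r} \<Longrightarrow> v \<notin> siblings V r f \<Longrightarrow> f w = f v \<Longrightarrow> w = v"
  unfolding siblings_def by blast

text \<open>\<open>K\<close> stands for the separators; \<open>f\<close> and \<open>g\<close> are
  parents chosen along \<open>L\<close> and \<open>M\<close>. The data are symmetric, so by
  \<open>swap\<close> every statement about \<open>f\<close> has a counterpart for
  \<open>g\<close>.\<close>

locale order_pair_branchings =
  fixes V :: "'v set" and E r l K L M f g
  assumes V: "finite V" "r \<in> V" "E \<subseteq> V \<times> (V - {r})" "irrefl E"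
    and l: "leaf_bound V E r l"
    and L: "trans L" "irrefl L" and M: "trans M" "irrefl M"
    and f: "\<And>v. v \<in> V - {r} \<Longrightarrow> (f v, v) \<in> E \<and> (f v, v) \<in> L"
    and g: "\<And>v. v \<in> V - {r} \<Longrightarrow> (g v, v) \<in> E \<and> (g v, v) \<in> M"
    and K: "finite K" "\<And>x y. x \<in> V - {r} \<Longrightarrow> x \<notin> K \<Longrightarrow> y \<in> V \<Longrightarrow> (x, y) \<in> L \<Longrightarrow> (x, y) \<in> M \<Longrightarrow> False"
begin

lemma branchings: "branching V E r f" "branching V E r g"
  by (rule branchingI[OF f L], assumption) (rule branchingI[OF g M])

lemma swap: "order_pair_branchings V E r l K M L g f"
  by (intro order_pair_branchings.intro V l L M f g K(1)) (use K(2) in blast)+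

lemma below_f: "(x, y) \<in> (par V r f)\<^sup>* \<Longrightarrow> x \<noteq> y \<Longrightarrow> (x, y) \<in> L"
  using par_rtrancl_order[of V r f L x y] f L(1) by blast

lemma below_g: "(x, y) \<in> (par V r g)\<^sup>* \<Longrightarrow> x \<noteq> y \<Longrightarrow> (x, y) \<in> M"
  using par_rtrancl_order[of V r g M x y] g M(1) by blast

text \<open>A common parent precedes \<open>v\<close> in both orders.\<close>

lemma common_parent: "v \<in> V - {r} \<Longrightarrow> f v = g v \<Longrightarrow> f v \<in> insert r K"
  using f[of v] g[of v] V(3) K(2)[of "f v" v] by auto

text \<open>Vertices without siblings have distinct parents, here in \<open>insert r K\<close>; the
  rest are counted by \<open>card_siblings\<close>.\<close>

lemma card_common_parent: "card {v \<in> V - {r}. f v = g v} + 1 \<le> 2 * l + card K"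
proof -
  define N where "N = {v \<in> V - {r}. f v = g v}"
  define S where "S = siblings V r f"
  have "card (N - S) \<le> card (insert r K)"
  proof (rule card_inj_on_le)
    show "inj_on f (N - S)" unfolding inj_on_def N_def S_def using not_siblingD[of _ V r _ f] by blast
    show "f ` (N - S) \<subseteq> insert r K" using common_parent unfolding N_def by blast
  qed (use K in simp)
  also have "\<dots> \<le> card K + 1" using K by (simp add: card_insert_if)
  finally have "card (N - S) \<le> card K + 1" .
  moreover have "card N \<le> card (N - S) + card S"
  proof -
    have "finite S" unfolding S_def siblings_def using V by simp
    then have "card N \<le> card ((N - S) \<union> S)" using V by (intro card_mono) (auto simp: N_def)
    also have "\<dots> \<le> card (N - S) + card S" by (rule card_Un_le)
    finally show ?thesis .
  qed
  ultimately show ?thesis using card_siblings[OF V(1,2) l branchings(1)] unfolding N_def S_def by linarith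
qed

text \<open>
  If \<open>u = f v\<close> has no child but \<open>v\<close> and \<open>g u\<close> lies below \<open>u\<close> in the branching of \<open>f\<close>, then \<open>g u\<close>
  lies below \<open>v\<close> in both branchings unless \<open>g u = v\<close>. So each \<open>v\<close> counted here is exceptional,
  or has an exceptional parent to which it can be charged.
\<close>

lemma card_simple_parent_arcs:
  "card {v \<in> V - {r} - K. v \<notin> side_entered V E r g \<and> f v \<noteq> g v \<and> (v, f v) \<notin> E} \<le> 8 * l + card K"
proof -
  define X where "X = {v \<in> V - {r} - K. v \<notin> side_entered V E r g \<and> f v \<noteq> g v \<and> (v, f v) \<notin> E}"
  define S where "S = siblings V r f"
  define A where "A = side_entered V E r f"
  define U where "U = {v \<in> V - {r}. f v = g v}"
  \<comment> \<open>Elements of \<open>X1\<close> are charged to themselves or their parents in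
    \<open>S\<close>, those of \<open>X2\<close> to their parents in \<open>A\<close>, those of
    \<open>X4\<close> to their grandparents, which are common parents and lie in
    \<open>insert r K\<close>. \<open>X3\<close> has at most one element. The bounds are 2l - 2, 6l
    - 4, |K| + 1 and 1.\<close>
  define X1 where "X1 = {v \<in> X. v \<in> S \<or> f v \<in> S \<inter> U}"
  define X2 where "X2 = {v \<in> X - S. f v \<in> A}"
  define X3 where "X3 = {v \<in> X - S. f v = r}"
  define X4 where "X4 = {v \<in> X - S. f v \<in> U - S}"
  have XV: "X \<subseteq> V - {r}" unfolding X_def by blast
  have fin: "finite S" "finite A" "finite X" "finite X1" "finite X2" "finite X3" "finite X4"
    using V(1) unfolding S_def A_def siblings_def side_entered_def X1_def X2_def X3_def X4_def X_def by auto
  have inj: "v = w" if "v \<in> X - S" "w \<in> V - {r}" "f v = f w" for v w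
    using that not_siblingD[of v V r w f] XV unfolding S_def by auto
  have "card X1 \<le> card S"
  proof (rule card_inj_on_le[of "\<lambda>v. if v \<in> S then v else f v"])
    show "(\<lambda>v. if v \<in> S then v else f v) ` X1 \<subseteq> S" unfolding X1_def by auto
    \<comment> \<open>\<open>X\<close> and \<open>U\<close> are disjoint, so a vertex charged for
      itself is never the charged parent of another one.\<close>
    show "inj_on (\<lambda>v. if v \<in> S then v else f v) X1"
    proof (rule inj_onI)
      fix v w assume vw: "v \<in> X1" "w \<in> X1" "(if v \<in> S then v else f v) = (if w \<in> S then w else f w)"
      have XU: "x \<notin> U" if "x \<in> X1" for x using that unfolding X1_def X_def U_def by blast
      consider "v \<in> S" "w \<in> S" | "v \<in> S" "w \<notin> S" | "v \<notin> S" "w \<in> S" | "v \<notin> S" "w \<notin> S" by blast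
      then show "v = w"
      proof cases
        case 1
        then show ?thesis using vw(3) by simp
      next
        case 2
        then have "v = f w" "f w \<in> U" using vw(2,3) unfolding X1_def by auto
        then show ?thesis using XU[OF vw(1)] by simp
      next
        case 3
        then have "w = f v" "f v \<in> U" using vw(1,3) unfolding X1_def by auto
        then show ?thesis using XU[OF vw(2)] by simp
      next
        case 4
        then have "v \<in> X - S" "w \<in> V - {r}" "f v = f w" using vw XV unfolding X1_def by auto
        then show ?thesis by (rule inj)
      qed
    qed
  qed (rule fin)
  moreover have "card X2 \<le> card A"
  proof (rule card_inj_on_le[of f])
    show "inj_on f X2"
    proof (rule inj_onI)
      fix v w assume "v \<in> X2" "w \<in> X2" "f v = f w"
      moreover from this have "v \<in> X - S" "w \<in> V - {r}" using XV unfolding X2_def by auto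
      ultimately show "v = w" using inj[of v w] by simp
    qed
    show "f ` X2 \<subseteq> A" unfolding X2_def by blast
  qed (rule fin)
  moreover have "card X3 \<le> 1"
  proof -
    have "v = w" if "v \<in> X3" "w \<in> X3" for v w using inj[of v w] that XV unfolding X3_def by auto
    then show ?thesis using fin(6) by (simp add: card_le_Suc0_iff_eq)
  qed
  moreover have "card X4 \<le> card (insert r K)"
  proof (rule card_inj_on_le[of "f \<circ> f"])
    show "inj_on (f \<circ> f) X4"
    proof (rule inj_onI)
      fix v w assume vw: "v \<in> X4" "w \<in> X4" "(f \<circ> f) v = (f \<circ> f) w"
      then have "f v \<in> V - {r}" "f w \<in> V - {r}" "f w \<notin> siblings V r f" unfolding X4_def U_def S_def by auto
      then have "f v = f w" using not_siblingD[of "f w" V r "f v" f] vw(3) by simp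
      moreover have "v \<in> X - S" "w \<in> V - {r}" using vw XV unfolding X4_def by auto
      ultimately show "v = w" using inj[of v w] by simp
    qed
    show "(f \<circ> f) ` X4 \<subseteq> insert r K" using common_parent unfolding X4_def U_def by auto
  qed (use K in simp)
  moreover have "card (insert r K) \<le> card K + 1" using K by (simp add: card_insert_if)
  moreover have "X \<subseteq> X1 \<union> X2 \<union> X3 \<union> X4"
  proof (rule subsetI, rule ccontr)
    fix v assume v: "v \<in> X" "v \<notin> X1 \<union> X2 \<union> X3 \<union> X4"
    define u where "u = f v"
    have vV: "v \<in> V - {r}" "v \<notin> K" and v_g: "v \<notin> side_entered V E r g" "u \<noteq> g v" "(v, u) \<notin> E" and vS: "v \<notin> S"
      using v unfolding X_def X1_def u_def by blast+
    have uv: "(u, v) \<in> E" using f[OF vV(1)] unfolding u_def by blast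
    have u: "u \<in> V - {r}" "u \<notin> A" "f u \<noteq> g u"
      using v uv V(3) vS unfolding X1_def X2_def X3_def X4_def U_def u_def by blast+
    \<comment> \<open>\<open>u\<close> is an in-neighbour of \<open>v\<close> other than
      \<open>g v\<close>, so it lies properly below \<open>v\<close> in the branching of
      \<open>g\<close>; hence its parent \<open>g u\<close> lies below \<open>v\<close> or equals
      it.\<close>
    have "(v, u) \<in> (par V r g)\<^sup>*" using v_g uv vV(1) unfolding side_entered_def by blast
    moreover have "v \<noteq> u" using uv V(4) unfolding irrefl_def by blast
    ultimately obtain y where "(v, y) \<in> (par V r g)\<^sup>*" "(y, u) \<in> par V r g" by (metis rtranclE)
    then have vgu: "(v, g u) \<in> (par V r g)\<^sup>*" by (simp add: par_iff)
    have gu: "(g u, u) \<in> E" using g[OF u(1)] by blast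
    then have "(u, g u) \<in> (par V r f)\<^sup>*" using u unfolding A_def side_entered_def by fastforce
    moreover have "u \<noteq> g u" using gu V(4) unfolding irrefl_def by metis
    ultimately obtain z where z: "(u, z) \<in> par V r f" "(z, g u) \<in> (par V r f)\<^sup>*" by (metis converse_rtranclE)
    then have "z = v" using vS not_siblingD[OF vV(1), of z f] unfolding S_def u_def par_iff by auto
    then have vfu: "(v, g u) \<in> (par V r f)\<^sup>*" using z by blast
    have "v \<noteq> g u" using gu v_g by blast
    then have "(v, g u) \<in> L" "(v, g u) \<in> M"
      using below_f[OF vfu] below_g[OF vgu] by blast+
    then show False using K(2)[OF vV] gu V(3) by blast
  qed
  then have "card X \<le> card (X1 \<union> X2 \<union> X3 \<union> X4)" using fin by (intro card_mono) auto
  moreover have "card (X1 \<union> X2 \<union> X3 \<union> X4) \<le> card X1 + card X2 + card X3 + card X4"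
    by (meson add_le_mono card_Un_le le_refl le_trans)
  ultimately show ?thesis
    using card_siblings[OF V(1,2) l branchings(1)] card_side_entered[OF V(1,2) l branchings(1) V(4)]
    unfolding X_def[symmetric] S_def[symmetric] A_def[symmetric] by linarith
qed

text \<open>An in-neighbour of \<open>v\<close> other than \<open>f v\<close> and \<open>g v\<close>
  would, for unexceptional \<open>v\<close>, lie below \<open>v\<close> in both branchings and so
  after it in both orders. Hence the in-degree is at most 2, and a one-way arc into \<open>v\<close>
  comes from a parent, which puts \<open>v\<close> in \<open>X\<close> or \<open>X'\<close>. Each of
  \<open>K\<close>, \<open>N\<close>, \<open>X\<close> and \<open>X'\<close> contributes one
  |K|.\<close>

lemma card_special:
  "card {v \<in> V. 3 \<le> card {u. (u, v) \<in> E} \<or> (\<exists>u. (u, v) \<in> E \<and> (v, u) \<notin> E)} \<le> 30 * l + 4 * card K"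
proof -
  define Y where "Y = {v \<in> V. 3 \<le> card {u. (u, v) \<in> E} \<or> (\<exists>u. (u, v) \<in> E \<and> (v, u) \<notin> E)}"
  define A where "A = side_entered V E r f"
  define B where "B = side_entered V E r g"
  define N where "N = {v \<in> V - {r}. f v = g v}"
  define X where "X = {v \<in> V - {r} - K. v \<notin> side_entered V E r g \<and> f v \<noteq> g v \<and> (v, f v) \<notin> E}"
  define X' where "X' = {v \<in> V - {r} - K. v \<notin> side_entered V E r f \<and> g v \<noteq> f v \<and> (v, g v) \<notin> E}"
  have fin: "finite A" "finite B" "finite N" "finite X" "finite X'"
    using V(1) unfolding A_def B_def side_entered_def N_def X_def X'_def by auto
  have "Y \<subseteq> K \<union> A \<union> B \<union> N \<union> X \<union> X'"
  proof (rule subsetI, rule ccontr)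
    fix v assume v: "v \<in> Y" "v \<notin> K \<union> A \<union> B \<union> N \<union> X \<union> X'"
    have "v \<noteq> r"
    proof
      assume "v = r"
      then have no: "(u, v) \<notin> E" for u using V(3) by blast
      then show False using v(1) unfolding Y_def by simp
    qed
    then have vV: "v \<in> V - {r}" "v \<notin> K" using v unfolding Y_def by blast+
    have ins: "x = f v \<or> x = g v" if x: "(x, v) \<in> E" for x
    proof (rule ccontr)
      assume "\<not> (x = f v \<or> x = g v)"
      then have "(v, x) \<in> (par V r f)\<^sup>*" "(v, x) \<in> (par V r g)\<^sup>*"
        using v(2) x vV(1) unfolding A_def B_def side_entered_def by blast+
      moreover have "v \<noteq> x" using x V(4) unfolding irrefl_def by blast
      ultimately have "(v, x) \<in> L" "(v, x) \<in> M" using below_f below_g by blast+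
      then show False using K(2)[OF vV] x V(3) by blast
    qed
    then have "card {u. (u, v) \<in> E} \<le> card {f v, g v}" by (intro card_mono) auto
    also have "\<dots> \<le> 2" by (simp add: card_insert_if)
    finally obtain u where "(u, v) \<in> E" "(v, u) \<notin> E" using v(1) unfolding Y_def by auto
    then show False using v(2) vV ins unfolding X_def X'_def A_def B_def N_def by auto
  qed
  then have "card Y \<le> card (K \<union> A \<union> B \<union> N \<union> X \<union> X')" using fin K by (intro card_mono) auto
  also have "\<dots> \<le> card K + card A + card B + card N + card X + card X'"
    by (meson add_le_mono card_Un_le le_refl le_trans)
  finally have "card Y \<le> card K + card A + card B + card N + card X + card X'" .
  moreover have "card A + 4 \<le> 6 * l" "card B + 4 \<le> 6 * l"
    unfolding A_def B_def
    by (rule card_side_entered[OF V(1,2) l branchings(1) V(4)], rule card_side_entered[OF V(1,2) l branchings(2) V(4)])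
  moreover have "card N + 1 \<le> 2 * l + card K" unfolding N_def by (rule card_common_parent)
  moreover have "card X \<le> 8 * l + card K" unfolding X_def by (rule card_simple_parent_arcs)
  moreover have "card X' \<le> 8 * l + card K"
    unfolding X'_def by (rule order_pair_branchings.card_simple_parent_arcs[OF swap])
  ultimately show ?thesis unfolding Y_def by linarith
qed

end

section \<open>Special vertices and separators against leaves\<close>

lemma finite_separators:
  assumes "rooted V E r"
  shows "finite {c. separator V E r c}"
proof (rule finite_subset)
  show "{c. separator V E r c} \<subseteq> V" using rootedD(3)[OF assms] unfolding separator_def entry_def by blast
qed (rule rootedD(1)[OF assms])

lemma branching_exists:
  assumes D: "rooted V E r"
  shows "\<exists>f. branching V E r f"
proof -
  obtain L M where LM: "order_pair V E r L M" using order_pair_exists[OF D] by blast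
  then have "\<forall>v \<in> V - {r}. \<exists>u. (u, v) \<in> E \<and> (u, v) \<in> L" unfolding order_pair_def by blast
  then obtain f where "\<forall>v \<in> V - {r}. (f v, v) \<in> E \<and> (f v, v) \<in> L" by metis
  then show ?thesis using LM branchingI[of V r f E L] unfolding order_pair_def by blast
qed

theorem card_special_le:
  assumes D: "rooted V E r" and l: "leaf_bound V E r l"
  shows "card {v \<in> V. 3 \<le> card {u. (u, v) \<in> E} \<or> (\<exists>u. (u, v) \<in> E \<and> (v, u) \<notin> E)}
    \<le> 30 * l + 4 * card {c. separator V E r c}"
proof -
  obtain L M where LM: "order_pair V E r L M" using order_pair_exists[OF D] by blast
  then have "\<forall>v \<in> V - {r}. \<exists>u. (u, v) \<in> E \<and> (u, v) \<in> L" "\<forall>v \<in> V - {r}. \<exists>u. (u, v) \<in> E \<and> (u, v) \<in> M"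
    unfolding order_pair_def by blast+
  then obtain f g where fg: "\<forall>v \<in> V - {r}. (f v, v) \<in> E \<and> (f v, v) \<in> L" "\<forall>v \<in> V - {r}. (g v, v) \<in> E \<and> (g v, v) \<in> M"
    by metis
  have "order_pair_branchings V E r l {c. separator V E r c} L M f g"
  proof (rule order_pair_branchings.intro)
    show "trans L" "irrefl L" "trans M" "irrefl M" using LM unfolding order_pair_def by blast+
    show False if "x \<in> V - {r}" "x \<notin> {c. separator V E r c}" "y \<in> V" "(x, y) \<in> L" "(x, y) \<in> M" for x y
      using LM that unfolding order_pair_def by blast
  qed (use l fg rootedD[OF D] finite_separators[OF D] in blast)+
  then interpret order_pair_branchings V E r l "{c. separator V E r c}" L M f g .
  show ?thesis by (rule card_special)
qed

text \<open>
  A vertex dominated by an in-neighbour \<open>c\<close> lies below \<open>c\<close> in every branching, so it may be attached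
  to \<open>c\<close> directly; then every separator has two children.
\<close>

theorem card_separators_le:
  assumes D: "rooted V E r" and l: "leaf_bound V E r l"
    and two: "\<And>c. separator V E r c \<Longrightarrow>
      \<exists>A \<subseteq> V - {r}. entry E A = {c} \<and> (\<exists>x \<in> A. \<exists>y \<in> A. x \<noteq> y \<and> (c, x) \<in> E \<and> (c, y) \<in> E)"
  shows "card {c. separator V E r c} \<le> l"
proof -
  note V = rootedD[OF D]
  obtain f where f: "branching V E r f" using branching_exists[OF D] by blast
  define P where "P = (par V r f)\<^sup>+"
  have P: "trans P" "irrefl P" using f unfolding P_def branching_def acyclic_def irrefl_def by auto
  have fP: "(f v, v) \<in> E \<and> (f v, v) \<in> P" if "v \<in> V - {r}" for v
    using f that unfolding branching_def P_def by (auto simp: par_iff)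
  define dom where "dom = (\<lambda>c x. (c, x) \<in> E \<and> (\<exists>A \<subseteq> V - {r}. x \<in> A \<and> entry E A = {c}))"
  \<comment> \<open>Going up from \<open>x\<close> through its ancestors, the branching can leave
    \<open>A\<close> only at \<open>c\<close>.\<close>
  have below: "(c, x) \<in> P" if "A \<subseteq> V - {r}" "x \<in> A" "entry E A = {c}" for A c x
    using wf_par[OF V(1) f] that(2)
  proof (induction x rule: wf_induct_rule)
    case (less x)
    then have x: "(f x, x) \<in> par V r f" "(f x, x) \<in> E" "(f x, x) \<in> P" using that(1) fP by (auto simp: par_iff)
    then have "f x \<in> A \<or> f x = c" using less.prems that(3) unfolding entry_def by blast
    then show ?case using less.IH[OF x(1)] x(3) P(1) by (meson transD)
  qed
  \<comment> \<open>If both \<open>c\<close> and \<open>d\<close> dominate \<open>x\<close>, each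
    lies in a set cut off by the other, hence below it.\<close>
  have unique: "c = d" if cd: "dom c x" "dom d x" for c d x
  proof (rule ccontr)
    assume "c \<noteq> d"
    have "(c', d') \<in> P" if cd': "dom c' x" "dom d' x" "c' \<noteq> d'" for c' d'
    proof -
      obtain A where A: "A \<subseteq> V - {r}" "x \<in> A" "entry E A = {c'}" using cd'(1) unfolding dom_def by blast
      have "(d', x) \<in> E" using cd'(2) unfolding dom_def by blast
      then have "d' \<in> A \<or> d' \<in> entry E A" using A(2) unfolding entry_def by auto
      then have "d' \<in> A" using A(3) cd'(3) by auto
      then show ?thesis using below[OF A(1) _ A(3)] by blast
    qed
    then have "(c, d) \<in> P" "(d, c) \<in> P" using cd \<open>c \<noteq> d\<close> by blast+
    then show False using P unfolding irrefl_def by (meson transD)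
  qed
  define h where "h = (\<lambda>x. if \<exists>c. dom c x then THE c. dom c x else f x)"
  have h_dom: "h x = c" if "dom c x" for c x
  proof -
    have "(THE c. dom c x) = c" using that unique by blast
    then show ?thesis using that unfolding h_def by auto
  qed
  have h: "branching V E r h"
  proof (rule branchingI[OF _ P])
    fix v assume v: "v \<in> V - {r}"
    show "(h v, v) \<in> E \<and> (h v, v) \<in> P"
    proof (cases "\<exists>c. dom c v")
      case True
      then show ?thesis using h_dom below unfolding dom_def by metis
    next
      case False
      then show ?thesis using fP[OF v] unfolding h_def by auto
    qed
  qed
  define S where "S = siblings V r h"
  have S: "finite S" unfolding S_def siblings_def using V by simp
  have "{c. separator V E r c} \<subseteq> h ` S"
  proof
    fix c assume "c \<in> {c. separator V E r c}"
    then have "separator V E r c" by simp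
    from two[OF this] obtain A where A0: "A \<subseteq> V - {r}" "entry E A = {c}"
      "\<exists>x \<in> A. \<exists>y \<in> A. x \<noteq> y \<and> (c, x) \<in> E \<and> (c, y) \<in> E" by blast
    from A0(3) obtain x y where xy: "x \<in> A" "y \<in> A" "x \<noteq> y" "(c, x) \<in> E" "(c, y) \<in> E" by blast
    note A = A0(1,2) xy
    then have "dom c x" "dom c y" unfolding dom_def by blast+
    then have "h x = c" "h y = c" using h_dom by blast+
    moreover have "x \<in> V - {r}" "y \<in> V - {r}" using A(1,3,4) by blast+
    ultimately have "x \<in> S" using A(5) unfolding S_def siblings_def by auto
    then show "c \<in> h ` S" using \<open>h x = c\<close> by blast
  qed
  then have "card {c. separator V E r c} \<le> card (h ` S)" using S by (intro card_mono) auto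
  \<comment> \<open>Siblings come in groups of at least two, so there are at most half as many
    parents of siblings as siblings.\<close>
  moreover have "2 * card (h ` S) \<le> card S"
  proof -
    have "{x \<in> S. \<exists>y \<in> S. y \<noteq> x \<and> h y = h x} = S"
    proof
      show "S \<subseteq> {x \<in> S. \<exists>y \<in> S. y \<noteq> x \<and> h y = h x}"
      proof
        fix x assume x: "x \<in> S"
        then obtain y where y: "y \<in> V - {r}" "y \<noteq> x" "h y = h x" unfolding S_def siblings_def by blast
        then have "y \<in> S" using x unfolding S_def siblings_def by force
        then show "x \<in> {x \<in> S. \<exists>y \<in> S. y \<noteq> x \<and> h y = h x}" using x y by blast
      qed
    qed blast
    then show ?thesis using card_nonunique_image[OF S, of h] by simp
  qed
  moreover have "card S + 2 \<le> 2 * l" unfolding S_def by (rule card_siblings[OF V(1,2) l h])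
  ultimately show ?thesis by linarith
qed

section \<open>Outbranchings of rooted digraphs\<close>

lemma pcas_append: "pcas u (p @ q) v \<longleftrightarrow> (\<exists>w. pcas u p w \<and> pcas w q v)"
  by (induction p arbitrary: u) auto

text \<open>On an undirected cycle, both neighbours of a lowest vertex are its parent.\<close>

lemma closed_walk_of_arborescence:
  assumes R: "finite R" "acyclic R" "\<And>u v w. (u, w) \<in> R \<Longrightarrow> (v, w) \<in> R \<Longrightarrow> u = v"
    and p: "set p \<subseteq> R \<union> R\<inverse>" "pcas u p u" "p \<noteq> []" "distinct (map snd p)"
  shows "length p = 2"
proof -
  have "wf (R\<inverse>)" using R(1,2) by (rule finite_acyclic_wf_converse)
  then obtain x where x: "x \<in> snd ` set p" "\<And>y. (x, y) \<in> R \<Longrightarrow> y \<notin> snd ` set p"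
    using p(3) wfE_min[of "R\<inverse>" "snd (hd p)" "snd ` set p"] by (metis converseI hd_in_set image_eqI)
  then obtain e where e: "e \<in> set p" "snd e = x" by blast
  then obtain q s where qs: "p = q @ e # s" by (meson split_list)
  have closed: "pcas x (s @ q @ [e]) x"
  proof -
    obtain w where "pcas u q w" "pcas w (e # s) u" using p(2) qs pcas_append by metis
    then have "pcas x s u" "pcas u (q @ [e]) x" using e(2) pcas_append by force+
    then show ?thesis using pcas_append[of x s "q @ [e]" x] by blast
  qed
  have snd_fst: "fst ` set c \<subseteq> snd ` set c" if c: "pcas a c a" for a and c :: "('a \<times> 'a) list"
  proof -
    have fst: "fst ` set c \<subseteq> insert a (snd ` set c)" if "pcas a c b" for a b using that by (induction c arbitrary: a) auto
    have last: "b \<in> insert a (snd ` set c)" if "pcas a c b" for a b and c :: "('a \<times> 'a) list"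
      using that by (induction c arbitrary: a) auto
    show ?thesis
    proof (cases c)
      case (Cons e d)
      then have "a \<in> snd ` set c" using c last[of "snd e" d a] by auto
      then show ?thesis using fst[OF c] by auto
    qed simp
  qed
  have R_parent: "(fst e, x) \<in> R"
  proof -
    have "fst e \<in> snd ` set p" using snd_fst[OF p(2)] e(1) by blast
    then have "(x, fst e) \<notin> R" using x(2) by blast
    then show ?thesis using e p(1) by (cases e) auto
  qed
  have set_eq: "set (s @ q @ [e]) = set p" unfolding qs by auto
  show ?thesis
  proof (cases "s @ q")
    case Nil
    then have "fst e = x" using closed by simp
    then show ?thesis using R_parent R(2) by (auto simp: acyclic_def)
  next
    case (Cons e1 m)
    then have "s @ q @ [e] = e1 # m @ [e]" by (metis append.assoc append_Cons)
    from closed[unfolded this] have c: "fst e1 = x" "pcas (snd e1) (m @ [e]) x" by simp_all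
    have e1: "e1 \<in> set p" using Cons set_eq by (metis append_assoc in_set_conv_decomp append_Cons append_Nil)
    then have "(x, snd e1) \<notin> R" using x(2) by blast
    then have "(snd e1, x) \<in> R" using e1 p(1) c(1) by (cases e1) auto
    then have eq: "snd e1 = fst e" using R(3) R_parent by blast
    \<comment> \<open>Any arcs between \<open>e1\<close> and \<open>e\<close> would lead back to the
      parent of \<open>x\<close>, which \<open>e1\<close> has already reached.\<close>
    have "m = []"
    proof (rule ccontr)
      assume "m \<noteq> []"
      then obtain m' e2 where m: "m = m' @ [e2]" by (meson rev_exhaust)
      then have "snd e2 = fst e" using c(2) by (auto simp: pcas_append)
      moreover have "distinct (map snd (s @ q))" using p(4) unfolding qs by auto
      ultimately show False using eq unfolding Cons m by simp
    qed
    then show ?thesis using Cons qs by (metis One_nat_def Suc_1 append_Nil2 length_Cons length_append list.size(3) add.commute add_Suc_right)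
  qed
qed

text \<open>As parents are unique, the descendants of \<open>v\<close> are joined to the other
  vertices only by the arc from \<open>x\<close> to \<open>v\<close>, and the walk has to cross
  it.\<close>

lemma walk_enters_via_parent:
  assumes R: "\<And>u v w. (u, w) \<in> R \<Longrightarrow> (v, w) \<in> R \<Longrightarrow> u = v" and x: "(x, v) \<in> R"
    and p: "set p \<subseteq> R \<union> R\<inverse>" "pcas a p b" "(v, a) \<notin> R\<^sup>*" "(v, b) \<in> R\<^sup>*"
  shows "x \<in> set (pawalk_verts a p)"
  using p
proof (induction p arbitrary: a)
  case Nil
  then show ?case by simp
next
  case (Cons e p)
  obtain y where e: "e = (a, y)" using Cons.prems(2) by (cases e) auto
  show ?case
  proof (cases "(v, y) \<in> R\<^sup>*")
    case False
    then show ?thesis using Cons e by simp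
  next
    case True
    have "(y, a) \<notin> R" using True Cons.prems(3) by (meson rtrancl.rtrancl_into_rtrancl)
    then have ay: "(a, y) \<in> R" using Cons.prems(1) e by auto
    have "y = v"
    proof (rule ccontr)
      assume "y \<noteq> v"
      then obtain z where "(v, z) \<in> R\<^sup>*" "(z, y) \<in> R" using True by (metis rtranclE)
      then show False using R[OF ay] Cons.prems(3) by blast
    qed
    then show ?thesis using R[OF ay] x e by auto
  qed
qed

text \<open>The set of all unreachable vertices serves as \<open>A\<close>. The generality of
  \<open>wf_digraph\<close> allows applying this after deleting a vertex or an arc.\<close>

lemma (in wf_digraph) unreachable_iff_entry:
  assumes "r \<in> verts G" "w \<in> verts G"
  shows "\<not> r \<rightarrow>\<^sup>* w \<longleftrightarrow> (\<exists>A \<subseteq> verts G - {r}. w \<in> A \<and> entry (arcs_ends G) A = {})"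
proof
  assume w: "\<not> r \<rightarrow>\<^sup>* w"
  let ?A = "{v \<in> verts G. \<not> r \<rightarrow>\<^sup>* v}"
  have "entry (arcs_ends G) ?A = {}"
    unfolding entry_def using adj_in_verts reachable_adj_trans by blast
  then show "\<exists>A \<subseteq> verts G - {r}. w \<in> A \<and> entry (arcs_ends G) A = {}"
    using w assms by (intro exI[of _ ?A]) auto
next
  assume "\<exists>A \<subseteq> verts G - {r}. w \<in> A \<and> entry (arcs_ends G) A = {}"
  then obtain A where A: "A \<subseteq> verts G - {r}" "w \<in> A" "entry (arcs_ends G) A = {}" by blast
  have "v \<notin> A" if "r \<rightarrow>\<^sup>* v" for v
    using that by (induction rule: reachable_induct) (use A in \<open>auto simp: entry_def\<close>)
  then show "\<not> r \<rightarrow>\<^sup>* w" using A(2) by blast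
qed

definition arborescence :: "('a, 'b) pre_digraph \<Rightarrow> 'a \<Rightarrow> ('a \<Rightarrow> 'a) \<Rightarrow> ('a, 'b) pre_digraph" where
  "arborescence D r f = \<lparr>verts = verts D, arcs = {e \<in> arcs D. head D e \<noteq> r \<and> tail D e = f (head D e)},
     tail = tail D, head = head D\<rparr>"

section \<open>Cuts and outbranchings of a rooted digraph\<close>

context rooted_digraph
begin

abbreviation "V \<equiv> verts D"
abbreviation "E \<equiv> arcs_ends D"

lemma E_subset: "E \<subseteq> V \<times> (V - {r})"
proof -
  have "in_arcs D r = {}" using root_in_degree finite_in_arcs unfolding in_degree_def by simp
  then show ?thesis unfolding in_arcs_def arcs_ends_conv by auto
qed

lemma irrefl_E: "irrefl E"
  unfolding irrefl_def using adj_not_same by blast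

lemma rooted_iff: "rooted V E r \<longleftrightarrow> root_connected D r"
proof
  assume R: "rooted V E r"
  show "root_connected D r" unfolding root_connected_def
  proof (rule ballI, rule ccontr)
    fix v assume "v \<in> V" "\<not> r \<rightarrow>\<^sup>*\<^bsub>D\<^esub> v"
    then show False using unreachable_iff_entry[OF root_in_verts] rootedD(5)[OF R] by blast
  qed
next
  assume R: "root_connected D r"
  show "rooted V E r"
  proof (rule rootedI[OF finite_verts root_in_verts E_subset irrefl_E])
    fix A assume A: "A \<subseteq> V - {r}" "A \<noteq> {}"
    then obtain w where "w \<in> A" "w \<in> V" by blast
    then show "entry E A \<noteq> {}" using A(1) R unreachable_iff_entry[OF root_in_verts] unfolding root_connected_def by blast
  qed
qed

lemma separator_cut_vertex:
  assumes "separator V E r c"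
  shows "cut_vertex D r c"
proof -
  interpret H: wf_digraph "del_vert c" by (rule wf_digraph_del_vert)
  obtain A where A: "c \<noteq> r" "A \<subseteq> V - {r}" "A \<noteq> {}" "entry E A = {c}"
    using assms unfolding separator_def by blast
  have c: "c \<in> V" "c \<notin> A" using A(4) E_subset unfolding entry_def by blast+
  have "arcs_ends (del_vert c) \<subseteq> E - {c} \<times> UNIV" by (auto simp: arcs_ends_conv del_vert_simps)
  then have "entry (arcs_ends (del_vert c)) A = {}" using A(4) unfolding entry_def by blast
  moreover obtain w where "w \<in> A" using A(3) by blast
  moreover have "A \<subseteq> verts (del_vert c) - {r}" "r \<in> verts (del_vert c)"
    using A(1,2) c root_in_verts by (auto simp: del_vert_simps)
  ultimately have "w \<in> verts (del_vert c) \<and> \<not> r \<rightarrow>\<^sup>*\<^bsub>del_vert c\<^esub> w" using H.unreachable_iff_entry by blast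
  then show ?thesis using A(1) c(1) unfolding cut_vertex_def by blast
qed

lemma cut_edge_iff:
  "cut_edge D r e \<longleftrightarrow> e \<in> arcs D \<and> (\<exists>A \<subseteq> V - {r}. A \<noteq> {} \<and> entry (arcs_ends (del_arc e)) A = {})"
proof -
  interpret H: wf_digraph "del_arc e" by (rule wf_digraph_del_arc)
  show ?thesis unfolding cut_edge_def using H.unreachable_iff_entry[of r] root_in_verts by (auto 4 4)
qed

text \<open>Let \<open>A\<close> be the largest set entered only from \<open>c\<close>. If
  \<open>c\<close> had a single out-neighbour in \<open>A\<close>, the arc to it would be a
  cut-edge, hence there is a second cut-edge from \<open>c\<close>. Its deletion isolates a set
  \<open>B\<close> entered only from \<open>c\<close>, so \<open>B\<close> is part of
  \<open>A\<close> and contains a second out-neighbour after all.\<close>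

lemma separator_two_out_neighbours:
  assumes con: "root_connected D r" and cut: "\<And>e. cut_edge D r e \<Longrightarrow> branching_cut_edge D r e"
    and c: "separator V E r c"
  shows "\<exists>A \<subseteq> V - {r}. entry E A = {c} \<and> (\<exists>x \<in> A. \<exists>y \<in> A. x \<noteq> y \<and> (c, x) \<in> E \<and> (c, y) \<in> E)"
proof -
  have R: "rooted V E r" using con rooted_iff by blast
  define \<A> where "\<A> = {A. A \<subseteq> V - {r} \<and> entry E A = {c}}"
  define A where "A = \<Union>\<A>"
  have A: "A \<subseteq> V - {r}" "A \<noteq> {}" using c unfolding separator_def A_def \<A>_def by blast+
  have "entry E A \<subseteq> {c}" unfolding entry_def A_def \<A>_def by blast
  then have entA: "entry E A = {c}" using rootedD(5)[OF R A] by blast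
  then obtain x where x: "x \<in> A" "(c, x) \<in> E" unfolding entry_def by blast
  then obtain e where e: "e \<in> arcs D" "tail D e = c" "head D e = x" by (auto simp: arcs_ends_conv)
  have "\<exists>y \<in> A. x \<noteq> y \<and> (c, y) \<in> E"
  proof (rule ccontr)
    assume no: "\<not> ?thesis"
    have sub: "arcs_ends (del_arc e) \<subseteq> E - {(c, x)}"
      using e no_multi_arcs by (auto simp: arcs_ends_conv arc_to_ends_def)
    have "entry (arcs_ends (del_arc e)) A = {}"
    proof (rule ccontr)
      assume "\<not> ?thesis"
      then obtain u y where u: "u \<notin> A" "y \<in> A" "(u, y) \<in> E" "(u, y) \<noteq> (c, x)" using sub unfolding entry_def by blast
      then have "u \<in> entry E A" unfolding entry_def by blast
      then have "u = c" using entA by simp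
      then show False using u no by auto
    qed
    then have "cut_edge D r e" using e A cut_edge_iff by blast
    then obtain e' where e': "cut_edge D r e'" "e' \<noteq> e" "tail D e' = c"
      using cut e(2) unfolding branching_cut_edge_def by metis
    then obtain B where B: "e' \<in> arcs D" "B \<subseteq> V - {r}" "B \<noteq> {}" "entry (arcs_ends (del_arc e')) B = {}"
      using e'(1)[unfolded cut_edge_iff] by blast
    have "E \<subseteq> insert (c, head D e') (arcs_ends (del_arc e'))" using e'(3) by (auto simp: arcs_ends_conv)
    then have entB: "u = c \<and> head D e' \<in> B" if "u \<in> entry E B" for u
      using that B(4) unfolding entry_def by blast
    moreover have "entry E B \<noteq> {}" using rootedD(5)[OF R B(2,3)] .
    ultimately have "entry E B = {c}" "head D e' \<in> B" by blast+
    then have "head D e' \<in> A" using B(2) unfolding A_def \<A>_def by blast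
    moreover have "(c, head D e') \<in> E" using B(1) e'(3) by (auto simp: arcs_ends_conv)
    moreover have "head D e' \<noteq> x"
      using e e'(2,3) B(1) no_multi_arcs[of e e'] by (auto simp: arc_to_ends_def)
    ultimately show False using no by metis
  qed
  then show ?thesis using A(1) entA x by blast
qed

text \<open>Without parallel arcs, distinct arcs into \<open>v\<close> have distinct tails, so
  degrees count neighbours.\<close>

lemma sp_subset: "sp D \<subseteq> {v \<in> V. 3 \<le> card {u. (u, v) \<in> E} \<or> (\<exists>u. (u, v) \<in> E \<and> (v, u) \<notin> E)}"
proof -
  have "in_degree D v \<le> card {u. (u, v) \<in> E}" for v
    unfolding in_degree_def
  proof (rule card_inj_on_le[of "tail D"])
    show "inj_on (tail D) (in_arcs D v)"
      by (rule inj_onI) (auto simp: in_arcs_def arc_to_ends_def intro!: no_multi_arcs)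
    show "tail D ` in_arcs D v \<subseteq> {u. (u, v) \<in> E}" by (auto simp: in_arcs_def arcs_ends_conv)
    show "finite {u. (u, v) \<in> E}" using E_subset by (rule_tac finite_subset[of _ V]) auto
  qed
  then show ?thesis unfolding sp_def using le_trans by blast
qed

text \<open>As pairs, the arcs of the arborescence are exactly \<open>par V r f\<close>. Undirected
  walks thus run in this relation and its converse, where the two preceding lemmas on walks exclude
  cycles of length other than 2 and force paths to pass through the tail of an arc before its
  head.\<close>

lemma outbranching_arborescence:
  assumes f: "branching V E r f"
  shows "outbranching D r (arborescence D r f)" "leaves (arborescence D r f) = V - f ` (V - {r})"
proof -
  let ?T = "arborescence D r f"
  let ?R = "par V r f"
  have T: "verts ?T = V" "tail ?T = tail D" "head ?T = head D"
    "arcs ?T = {e \<in> arcs D. head D e \<noteq> r \<and> tail D e = f (head D e)}"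
    unfolding arborescence_def by auto
  interpret T: wf_digraph ?T
  proof
    fix e assume "e \<in> arcs ?T"
    then have "e \<in> arcs D" using T by simp
    then show "tail ?T e \<in> verts ?T" "head ?T e \<in> verts ?T" using T by simp_all
  qed
  have ends: "arcs_ends ?T = ?R"
  proof
    show "arcs_ends ?T \<subseteq> ?R" by (auto simp: arcs_ends_conv T par_iff)
    show "?R \<subseteq> arcs_ends ?T"
    proof
      fix a assume a: "a \<in> ?R"
      then have "a \<in> E" using f unfolding branching_def by blast
      then show "a \<in> arcs_ends ?T" using a by (force simp: arcs_ends_conv T par_def)
    qed
  qed
  have R: "finite ?R" "acyclic ?R" "\<And>u v w. (u, w) \<in> ?R \<Longrightarrow> (v, w) \<in> ?R \<Longrightarrow> u = v" "wf ?R"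
    using f wf_par[OF finite_verts f] unfolding branching_def par_def by auto
  have sym_arcs: "parcs (mk_symmetric ?T) = ?R \<union> ?R\<inverse>"
  proof -
    have "parcs (mk_symmetric ?T) = arcs_ends ?T \<union> (arcs_ends ?T)\<inverse>"
      unfolding parcs_mk_symmetric arcs_ends_conv by auto
    then show ?thesis unfolding ends .
  qed
  show "outbranching D r ?T" unfolding outbranching_def
  proof (intro conjI)
    show "spanning ?T D" unfolding spanning_def subgraph_def compatible_def
      using T T.wf_digraph wf_digraph by auto
    have reach: "r \<rightarrow>\<^sup>*\<^bsub>?T\<^esub> v" if "v \<in> V" for v
      using R(4) that
    proof (induction v rule: wf_induct_rule)
      case (less v)
      show ?case
      proof (cases "v = r")
        case True then show ?thesis using root_in_verts T by auto
      next
        case False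
        then have a: "(f v, v) \<in> ?R" using less.prems by (simp add: par_iff)
        then have "f v \<in> V" using f E_subset unfolding branching_def by blast
        then show ?thesis using less.IH[OF a] a ends T.reachable_adj_trans by blast
      qed
    qed
    have "u \<rightarrow>\<^sup>*\<^bsub>mk_symmetric ?T\<^esub> v" if uv: "u \<in> V" "v \<in> V" for u v
    proof -
      interpret S: pair_wf_digraph "mk_symmetric ?T" ..
      have "u \<rightarrow>\<^sup>*\<^bsub>mk_symmetric ?T\<^esub> r"
        by (rule symmetric_reachable[OF symmetric_mk_symmetric T.reachable_mk_symmetricI[OF reach[OF uv(1)]]])
      then show ?thesis by (rule S.reachable_trans) (rule T.reachable_mk_symmetricI[OF reach[OF uv(2)]])
    qed
    then have con: "Digraph_Component.connected ?T"
      unfolding connected_def strongly_connected_def using root_in_verts T by auto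
    have "length p = 2" if p: "pre_digraph.cycle (with_proj (mk_symmetric ?T)) p" for p
    proof -
      obtain u where u: "set p \<subseteq> ?R \<union> ?R\<inverse>" "pcas u p u" "distinct (tl (pawalk_verts u p))" "p \<noteq> []"
        using p sym_arcs unfolding pre_digraph.cycle_def pre_digraph.awalk_def
        by (auto simp: cas_with_proj_eq awalk_verts_with_proj_eq)
      have "pawalk_verts a q = a # map snd q" if "pcas a q b" for a b and q :: "('a \<times> 'a) list"
        using that by (induction q arbitrary: a) auto
      then have dist: "distinct (map snd p)" using u(2,3) by simp
      show ?thesis
      proof (rule closed_walk_of_arborescence[OF R(1,2) _ u(1,2,4) dist])
        fix a b w
        assume "(a, w) \<in> ?R" "(b, w) \<in> ?R"
        then show "a = b" by (rule R(3))
      qed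
    qed
    then show "underlying_tree ?T" unfolding underlying_tree_def using con by blast
    show "oriented_away ?T r" unfolding oriented_away_def
    proof (intro ballI allI impI)
      fix e p assume e: "e \<in> arcs ?T" and p: "pre_digraph.apath (with_proj (mk_symmetric ?T)) r p (head ?T e)"
      let ?v = "head D e"
      have tv: "(tail D e, ?v) \<in> ?R" using e ends by (auto simp: arcs_ends_conv T)
      have walk: "set p \<subseteq> ?R \<union> ?R\<inverse>" "pcas r p ?v"
        using p sym_arcs T unfolding pre_digraph.apath_def pre_digraph.awalk_def by (auto simp: cas_with_proj_eq)
      have not_below: "(?v, r) \<notin> ?R\<^sup>*"
      proof
        assume "(?v, r) \<in> ?R\<^sup>*"
        then show False by (rule rtranclE) (use e T in \<open>auto simp: par_iff\<close>)
      qed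
      have "tail D e \<in> set (pawalk_verts r p)"
      proof (rule walk_enters_via_parent[OF _ tv walk not_below])
        fix a b w
        assume "(a, w) \<in> ?R" "(b, w) \<in> ?R"
        then show "a = b" by (rule R(3))
      qed simp
      then show "tail ?T e \<in> set (pre_digraph.awalk_verts (with_proj (mk_symmetric ?T)) r p)"
        using T by (simp add: awalk_verts_with_proj_eq)
    qed
  qed
  have "finite (arcs ?T)" using T by simp
  then have "out_degree ?T v = 0 \<longleftrightarrow> v \<notin> Domain (arcs_ends ?T)" for v
    unfolding out_degree_def out_arcs_def by (auto simp: arcs_ends_conv)
  then show "leaves ?T = V - f ` (V - {r})"
    unfolding leaves_def ends using T by (auto simp: par_def)
qed

text \<open>\<open>Max\<close> bounds its members only for a finite set, so the leaf numbers are
  first bounded by the number of vertices.\<close>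

lemma leaf_bound_maxleaf: "leaf_bound V E r (maxleaf D r)"
  unfolding leaf_bound_def
proof (intro allI impI)
  fix f assume f: "branching V E r f"
  have "card (leaves T) \<le> card V" if "outbranching D r T" for T
  proof (rule card_mono[OF finite_verts])
    show "leaves T \<subseteq> V" using that unfolding outbranching_def spanning_def leaves_def by auto
  qed
  then have "{card (leaves T) | T. outbranching D r T} \<subseteq> {..card V}" by fast
  then have "finite {card (leaves T) | T. outbranching D r T}" by (rule finite_subset) simp
  then show "card (V - f ` (V - {r})) \<le> maxleaf D r"
    unfolding maxleaf_def using outbranching_arborescence[OF f] by (intro Max_ge) (auto intro!: exI)
qed

end

theorem theorem21:
  fixes D :: "('a, 'b) pre_digraph" and r :: 'a
  assumes "rooted_digraph D r"
    and "root_connected D r"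
    and "\<And>e. cut_edge D r e \<Longrightarrow> branching_cut_edge D r e"
  shows "real (maxleaf D r) \<ge> real (card (sp D)) / 30 - real (cv D r) \<and>
         real (maxleaf D r) \<ge> real (card (sp D)) / 60"
proof -
  interpret rooted_digraph D r by (rule assms(1))
  let ?K = "{c. separator V E r c}"
  have R: "rooted V E r" using assms(2) rooted_iff by blast
  have "card (sp D) \<le> card {v \<in> V. 3 \<le> card {u. (u, v) \<in> E} \<or> (\<exists>u. (u, v) \<in> E \<and> (v, u) \<notin> E)}"
    using sp_subset by (rule card_mono[rotated]) simp
  also have "\<dots> \<le> 30 * maxleaf D r + 4 * card ?K" by (rule card_special_le[OF R leaf_bound_maxleaf])
  finally have sp: "card (sp D) \<le> 30 * maxleaf D r + 4 * card ?K" .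
  have "?K \<subseteq> {v. cut_vertex D r v}" using separator_cut_vertex by blast
  moreover have "finite {v. cut_vertex D r v}"
    by (rule finite_subset[OF _ finite_verts]) (auto simp: cut_vertex_def)
  ultimately have cv: "card ?K \<le> cv D r" unfolding cv_def by (intro card_mono)
  have ml: "card ?K \<le> maxleaf D r"
    using card_separators_le[OF R leaf_bound_maxleaf separator_two_out_neighbours[OF assms(2,3)]] .
  \<comment> \<open>Raising 4 to 30 gives both estimates a common factor; the two bounds on the
    number of separators lead to the two claims.\<close>
  have "4 * card ?K \<le> 30 * cv D r" "4 * card ?K \<le> 30 * maxleaf D r"
    using cv ml by (auto intro: mult_le_mono)
  then have "card (sp D) \<le> 30 * maxleaf D r + 30 * cv D r" "card (sp D) \<le> 30 * maxleaf D r + 30 * maxleaf D r"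
    using sp by (meson add_left_mono le_trans)+
  then have "card (sp D) \<le> 30 * (maxleaf D r + cv D r)" "card (sp D) \<le> 60 * maxleaf D r" by simp_all
  then have "real (card (sp D)) \<le> real (30 * (maxleaf D r + cv D r))" "real (card (sp D)) \<le> real (60 * maxleaf D r)"
    unfolding of_nat_le_iff by blast+
  then show ?thesis by simp
qed

end
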